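(* Let $k\ge 1$ be an integer. For each $0<i\le k$, we have the following decomposition into irreducible $L(k,0)^{\mathbb{Z}_3}$-modules: $$L(k,i)=L(k,i)^0\oplus L(k,i)^1\oplus L(k,i)^2,$$ where: (1) if $k=1$ and $i=1$, then $L(1,1)^0$ (resp. $L(1,1)^1$, $L(1,1)^2$) is the irreducible $L(1,0)^{\mathbb{Z}_3}$-module generated by the lowest weight vector $v^{1,1}$ (resp. $v^{1,0}$, $f(-2)v^{1,1}$) with the lowest weight $\frac14$ (resp. $\frac14$, $\frac94$); (2) if $k>1$ and $i=1$, then $L(k,1)^0$ (resp. $L(k,1)^1$, $L(k,1)^2$) is the irreducible $L(k,0)^{\mathbb{Z}_3}$-module generated by the lowest weight vector $v^{1,1}$ (resp. $v^{1,0}$, $f(-1)v^{1,1}$) with the lowest weight $\frac{3}{4(k+2)}$ (resp. $\frac{3}{4(k+2)}$, $\frac{4k+11}{4(k+2)}$); (3) if $1<i\le k$, then $L(k,i)^0$, $L(k,i)^1$ and $L(k,i)^2$ are the irreducible $L(k,0)^{\mathbb{Z}_3}$-modules generated by the lowest weight vectors $v^{i,i}$, $v^{i,i-1}$ and $v^{i,i-2}$, respectively, with the same lowest weight $\frac{i(i+2)}{4(k+2)}$.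
   Context: $\{h,e,f\}$ is a standard Chevalley basis of $\mathfrak{sl}_2(\mathbb{C})$ with $[h,e]=2e$, $[h,f]=-2f$, $[e,f]=h$. $L(k,0)=L_{\widehat{\mathfrak{sl}_2}}(k,0)$ is the simple affine vertex operator algebra of level $k$; $a\in\mathfrak{sl}_2$ is identified with $a(-1)\mathbf{1}$, and on any module $Y(a(-1)\mathbf{1},z)=\sum_{n\in\mathbb{Z}}a(n)z^{-n-1}$. For $0\le i\le k$, $L(k,i)$ is the irreducible (integrable highest weight) $L(k,0)$-module whose lowest weight space is the $(i+1)$-dimensional irreducible $\mathfrak{sl}_2$-module with basis $v^{i,0},\dots,v^{i,i}$ and action $h(0)v^{i,j}=(i-2j)v^{i,j}$; $e(0)v^{i,0}=0$, $e(0)v^{i,j}=(i-j+1)v^{i,j-1}$ for $1\le j\le i$; $f(0)v^{i,i}=0$, $f(0)v^{i,j}=(j+1)v^{i,j+1}$ for $0\le j\le i-1$; $a(n)v^{i,j}=0$ for $a\in\{h,e,f\}$, $n\ge1$. The automorphism $\sigma$ of $\mathfrak{sl}_2(\mathbb{C})$ defined by $\sigma(h)=h$, $\sigma(e)=\frac{-1+\sqrt{-3}}{2}e$, $\sigma(f)=\frac{-1-\sqrt{-3}}{2}f$ lifts to an automorphism of $L(k,0)$ generating $\mathbb{Z}_3=\{1,\sigma,\sigma^2\}$, and $L(k,0)^{\mathbb{Z}_3}$ is the fixed point vertex operator subalgebra. Weights are $L(0)$-eigenvalues; the lowest weight of an irreducible module is the smallest $L(0)$-eigenvalue, and a lowest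 weight vector is a nonzero vector of that weight. *)

theory Defs
  imports "HOL-Analysis.Analysis" "HOL-Library.Groups_Big_Fun" "HOL-Library.Complex_Order"
begin

section \<open>Vertex operator algebras and their modules\<close>

text \<open>
  A complex vector space is a subspace \<open>carr\<close> of an ambient type with addition, together with
  a scalar multiplication on that type.  Substructures are obtained by shrinking \<open>carr\<close>.
  In a VOA, \<open>mode V a n b\<close> is \<open>a\<^sub>n b\<close>, where \<open>Y(a,z) = \<Sum>\<^sub>n a\<^sub>n z\<^bsup>-n-1\<^esup>\<close>; \<open>vac V\<close> is the vacuum and
  \<open>conf V\<close> the conformal vector.  Likewise \<open>act M a n w\<close> is \<open>a\<^sub>n w\<close> for a module \<open>M\<close>.
\<close>

record 'v cspace =
  carr :: "'v set"
  scal :: "complex \<Rightarrow> 'v \<Rightarrow> 'v"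

record 'v voa = "'v cspace" +
  mode :: "'v \<Rightarrow> int \<Rightarrow> 'v \<Rightarrow> 'v"
  vac  :: "'v"
  conf :: "'v"

record ('v, 'm) voa_mod = "'m cspace" +
  act :: "'v \<Rightarrow> int \<Rightarrow> 'm \<Rightarrow> 'm"

definition adjoint_module :: "'v voa \<Rightarrow> ('v, 'v) voa_mod" where
  "adjoint_module V = \<lparr>carr = carr V, scal = scal V, act = mode V\<rparr>"

definition finite_dim :: "(complex \<Rightarrow> 'm \<Rightarrow> 'm) \<Rightarrow> ('m::ab_group_add) set \<Rightarrow> bool" where
  "finite_dim s W \<longleftrightarrow> (\<exists>B. finite B \<and> W \<subseteq> module.span s B)"

definition internal_direct_sum ::
    "(complex \<Rightarrow> 'm \<Rightarrow> 'm) \<Rightarrow> ('m::ab_group_add) set \<Rightarrow> 'i set \<Rightarrow> ('i \<Rightarrow> 'm set) \<Rightarrow> bool" where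
  "internal_direct_sum s M I N \<longleftrightarrow>
     (\<forall>i\<in>I. module.subspace s (N i)) \<and>
     M = module.span s (\<Union>i\<in>I. N i) \<and>
     (\<forall>i\<in>I. N i \<inter> module.span s (\<Union>j\<in>I - {i}. N j) = {0})"

text \<open>
  The axiom \<open>borcherds\<close> is the Jacobi identity, written in components.  Both sums have finite
  support because of \<open>truncation\<close>.
\<close>

locale weak_module =
  V: vector_space "scal V" + M: vector_space "scal M"
  for V :: "('v::ab_group_add) voa" and M :: "('v, 'm::ab_group_add) voa_mod" +
  assumes V_subspace: "V.subspace (carr V)"
    and M_subspace: "M.subspace (carr M)"
    and vac_in: "vac V \<in> carr V"
    and mode_closed: "a \<in> carr V \<Longrightarrow> b \<in> carr V \<Longrightarrow> mode V a n b \<in> carr V"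
    and mode_truncation:
      "a \<in> carr V \<Longrightarrow> b \<in> carr V \<Longrightarrow> \<exists>N. \<forall>n\<ge>N. mode V a n b = 0"
    and act_closed: "a \<in> carr V \<Longrightarrow> w \<in> carr M \<Longrightarrow> act M a n w \<in> carr M"
    and act_add_left: "a \<in> carr V \<Longrightarrow> b \<in> carr V \<Longrightarrow> w \<in> carr M \<Longrightarrow>
          act M (a + b) n w = act M a n w + act M b n w"
    and act_scal_left: "a \<in> carr V \<Longrightarrow> w \<in> carr M \<Longrightarrow>
          act M (scal V x a) n w = scal M x (act M a n w)"
    and act_add_right: "a \<in> carr V \<Longrightarrow> w \<in> carr M \<Longrightarrow> w' \<in> carr M \<Longrightarrow>
          act M a n (w + w') = act M a n w + act M a n w'"
    and act_scal_right: "a \<in> carr V \<Longrightarrow> w \<in> carr M \<Longrightarrow>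
          act M a n (scal M x w) = scal M x (act M a n w)"
    and truncation: "a \<in> carr V \<Longrightarrow> w \<in> carr M \<Longrightarrow> \<exists>N. \<forall>n\<ge>N. act M a n w = 0"
    and act_vac: "w \<in> carr M \<Longrightarrow> act M (vac V) n w = (if n = -1 then w else 0)"
    and borcherds: "a \<in> carr V \<Longrightarrow> b \<in> carr V \<Longrightarrow> w \<in> carr M \<Longrightarrow>
          Sum_any (\<lambda>j::nat. scal M (of_int p gchoose j)
              (act M (mode V a (r + int j) b) (p + q - int j) w))
        = Sum_any (\<lambda>j::nat. scal M ((-1) ^ j * (of_int r gchoose j))
              (act M a (p + r - int j) (act M b (q + int j) w)
               - scal M ((-1) powi r) (act M b (q + r - int j) (act M a (p + int j) w))))"

text \<open>Eigenspaces of \<open>L(0)\<close>, where \<open>L(n) = \<omega>\<^bsub>n+1\<^esub>\<close> for the conformal vector \<open>\<omega>\<close>.\<close>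

definition weight_space ::
    "'v voa \<Rightarrow> ('v, 'm) voa_mod \<Rightarrow> complex \<Rightarrow> 'm set" where
  "weight_space V M l = {w \<in> carr M. act M (conf V) 1 w = scal M l w}"

locale vertex_operator_algebra =
  weak_module V "adjoint_module V" for V :: "('v::ab_group_add) voa" +
  assumes creation: "a \<in> carr V \<Longrightarrow> mode V a (-1) (vac V) = a"
    and creation_nonneg: "a \<in> carr V \<Longrightarrow> n \<ge> 0 \<Longrightarrow> mode V a n (vac V) = 0"
    and conf_in: "conf V \<in> carr V"
    and virasoro: "\<exists>c::complex. \<forall>m n. \<forall>a\<in>carr V.
          mode V (conf V) (m + 1) (mode V (conf V) (n + 1) a)
          - mode V (conf V) (n + 1) (mode V (conf V) (m + 1) a)
        = scal V (of_int (m - n)) (mode V (conf V) (m + n + 1) a)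
          + (if m + n = 0 then scal V (of_int (m ^ 3 - m) / 12 * c) a else 0)"
    and translation: "a \<in> carr V \<Longrightarrow> b \<in> carr V \<Longrightarrow>
          mode V (mode V (conf V) 0 a) n b = scal V (- of_int n) (mode V a (n - 1) b)"
    and grading: "internal_direct_sum (scal V) (carr V) (UNIV :: int set)
          (\<lambda>n. weight_space V (adjoint_module V) (of_int n))"
    and weight_finite_dim: "finite_dim (scal V) (weight_space V (adjoint_module V) (of_int n))"
    and weight_bounded:
      "\<exists>N::int. \<forall>n<N. weight_space V (adjoint_module V) (of_int n) = {0}"

locale voa_module =
  voa: vertex_operator_algebra V + weak_module V M
  for V :: "('v::ab_group_add) voa" and M :: "('v, 'm::ab_group_add) voa_mod" +
  assumes mod_grading:
      "internal_direct_sum (scal M) (carr M) (UNIV :: complex set) (weight_space V M)"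
    and mod_weight_finite_dim: "finite_dim (scal M) (weight_space V M l)"
    and mod_weight_bounded: "\<exists>N::int. \<forall>n<N. weight_space V M (l + of_int n) = {0}"

definition submodule ::
    "'v voa \<Rightarrow> ('v, 'm::ab_group_add) voa_mod \<Rightarrow> 'm set \<Rightarrow> bool" where
  "submodule V M N \<longleftrightarrow> N \<subseteq> carr M \<and> module.subspace (scal M) N \<and>
     (\<forall>a\<in>carr V. \<forall>n. \<forall>w\<in>N. act M a n w \<in> N)"

definition generated_submodule ::
    "'v voa \<Rightarrow> ('v, 'm::ab_group_add) voa_mod \<Rightarrow> 'm \<Rightarrow> 'm set" where
  "generated_submodule V M w = \<Inter>{N. submodule V M N \<and> w \<in> N}"

definition irreducible_module ::
    "('v::ab_group_add) voa \<Rightarrow> ('v, 'm::ab_group_add) voa_mod \<Rightarrow> bool" where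
  "irreducible_module V M \<longleftrightarrow> voa_module V M \<and> carr M \<noteq> {0} \<and>
     (\<forall>N. submodule V M N \<longrightarrow> N = {0} \<or> N = carr M)"

definition simple_voa :: "('v::ab_group_add) voa \<Rightarrow> bool" where
  "simple_voa V \<longleftrightarrow> irreducible_module V (adjoint_module V)"

text \<open>
  The order on \<^typ>\<open>complex\<close> compares numbers with equal imaginary parts by their real parts;
  the weights of an irreducible module lie in a single coset of the integers.
\<close>

definition is_lowest_weight ::
    "'v voa \<Rightarrow> ('v, 'm::ab_group_add) voa_mod \<Rightarrow> complex \<Rightarrow> bool" where
  "is_lowest_weight V M l \<longleftrightarrow> weight_space V M l \<noteq> {0} \<and>
     (\<forall>l'. weight_space V M l' \<noteq> {0} \<longrightarrow> l \<le> l')"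

definition lowest_weight_vector ::
    "'v voa \<Rightarrow> ('v, 'm::ab_group_add) voa_mod \<Rightarrow> complex \<Rightarrow> 'm \<Rightarrow> bool" where
  "lowest_weight_vector V M l w \<longleftrightarrow>
     is_lowest_weight V M l \<and> w \<in> weight_space V M l \<and> w \<noteq> 0"

definition irreducible_generated_by_lowest ::
    "('v::ab_group_add) voa \<Rightarrow> ('v, 'm::ab_group_add) voa_mod \<Rightarrow> 'm \<Rightarrow> complex \<Rightarrow> bool" where
  "irreducible_generated_by_lowest V M w l \<longleftrightarrow>
     irreducible_module V M \<and> lowest_weight_vector V M l w \<and> generated_submodule V M w = carr M"

definition voa_automorphism :: "('v::ab_group_add) voa \<Rightarrow> ('v \<Rightarrow> 'v) \<Rightarrow> bool" where
  "voa_automorphism V g \<longleftrightarrow> bij_betw g (carr V) (carr V) \<and>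
     (\<forall>a\<in>carr V. \<forall>b\<in>carr V. g (a + b) = g a + g b) \<and>
     (\<forall>x. \<forall>a\<in>carr V. g (scal V x a) = scal V x (g a)) \<and>
     (\<forall>a\<in>carr V. \<forall>b\<in>carr V. \<forall>n. g (mode V a n b) = mode V (g a) n (g b)) \<and>
     g (vac V) = vac V \<and> g (conf V) = conf V"

definition fixed_point_voa :: "'v voa \<Rightarrow> ('v \<Rightarrow> 'v) set \<Rightarrow> 'v voa" where
  "fixed_point_voa V G = V\<lparr>carr := {a \<in> carr V. \<forall>g\<in>G. g a = a}\<rparr>"


section \<open>The Lie algebra \<open>sl\<^sub>2\<close> and its affine vertex operator algebras\<close>

type_synonym mat2 = "complex ^ 2 ^ 2"

definition sl2 :: "mat2 set" where
  "sl2 = {a. trace a = 0}"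

definition mscale :: "complex \<Rightarrow> mat2 \<Rightarrow> mat2" where
  "mscale x a = (\<chi> r c. x * a $ r $ c)"

definition bracket :: "mat2 \<Rightarrow> mat2 \<Rightarrow> mat2" where
  "bracket a b = a ** b - b ** a"

definition sl2_h :: mat2 where "sl2_h = vector [vector [1, 0], vector [0, -1]]"
definition sl2_e :: mat2 where "sl2_e = vector [vector [0, 1], vector [0, 0]]"
definition sl2_f :: mat2 where "sl2_f = vector [vector [0, 0], vector [1, 0]]"

text \<open>An element \<open>a\<close> of \<open>sl\<^sub>2\<close> is \<open>a\<^sub>1\<^sub>1 h + a\<^sub>1\<^sub>2 e + a\<^sub>2\<^sub>1 f\<close>.\<close>

definition sl2_sigma :: "mat2 \<Rightarrow> mat2" where
  "sl2_sigma a = mscale (a $ 1 $ 1) sl2_h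
     + mscale (a $ 1 $ 2) (mscale ((-1 + \<i> * sqrt 3) / 2) sl2_e)
     + mscale (a $ 2 $ 1) (mscale ((-1 - \<i> * sqrt 3) / 2) sl2_f)"

lemma sl2_basis_in: "sl2_h \<in> sl2" "sl2_e \<in> sl2" "sl2_f \<in> sl2"
  by (simp_all add: sl2_def sl2_h_def sl2_e_def sl2_f_def trace_def sum_2)

lemma sl2_brackets:
  "bracket sl2_h sl2_e = mscale 2 sl2_e"
  "bracket sl2_h sl2_f = mscale (-2) sl2_f"
  "bracket sl2_e sl2_f = sl2_h"
  by (simp_all add: bracket_def mscale_def sl2_h_def sl2_e_def sl2_f_def
      matrix_matrix_mult_def vec_eq_iff forall_2 sum_2)

lemma sl2_sigma_basis:
  "sl2_sigma sl2_h = sl2_h"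
  "sl2_sigma sl2_e = mscale ((-1 + \<i> * sqrt 3) / 2) sl2_e"
  "sl2_sigma sl2_f = mscale ((-1 - \<i> * sqrt 3) / 2) sl2_f"
  by (simp_all add: sl2_sigma_def mscale_def sl2_h_def sl2_e_def sl2_f_def vec_eq_iff forall_2)

text \<open>
  \<open>V\<close> is (a copy of) \<open>L(k,0)\<close>.  The map \<open>\<iota>\<close> is the identification of \<open>a\<close> with \<open>a(-1)\<one>\<close>, so
  that \<open>a(n)\<close> is \<open>mode V (\<iota> a) n\<close>.  Since \<open>a(n)\<one> = 0\<close> for \<open>n \<ge> 0\<close> in every VOA, \<open>commutator\<close> and
  \<open>vacuum_generated\<close> say that \<open>V\<close> is a quotient of the vacuum module \<open>V(k,0)\<close> of level \<open>k\<close> for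
  the affine Lie algebra; here the invariant form is normalised as \<open>trace (a ** b)\<close>.
  \<open>simple\<close> makes it the simple quotient, and \<open>sugawara\<close> fixes the usual conformal vector, with
  \<open>h/2, f, e\<close> the basis dual to \<open>h, e, f\<close>.
\<close>

locale simple_affine_sl2_voa =
  vertex_operator_algebra V for V :: "('v::ab_group_add) voa" +
  fixes k :: nat and \<iota> :: "mat2 \<Rightarrow> 'v"
  assumes \<iota>_in: "a \<in> sl2 \<Longrightarrow> \<iota> a \<in> carr V"
    and \<iota>_add: "a \<in> sl2 \<Longrightarrow> b \<in> sl2 \<Longrightarrow> \<iota> (a + b) = \<iota> a + \<iota> b"
    and \<iota>_scal: "a \<in> sl2 \<Longrightarrow> \<iota> (mscale x a) = scal V x (\<iota> a)"
    and commutator: "a \<in> sl2 \<Longrightarrow> b \<in> sl2 \<Longrightarrow> u \<in> carr V \<Longrightarrow>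
          mode V (\<iota> a) m (mode V (\<iota> b) n u) - mode V (\<iota> b) n (mode V (\<iota> a) m u)
        = mode V (\<iota> (bracket a b)) (m + n) u
          + (if m + n = 0 then scal V (of_int m * trace (a ** b) * of_nat k) u else 0)"
    and vacuum_generated: "W \<subseteq> carr V \<Longrightarrow> V.subspace W \<Longrightarrow> vac V \<in> W \<Longrightarrow>
          (\<And>a n u. a \<in> sl2 \<Longrightarrow> u \<in> W \<Longrightarrow> mode V (\<iota> a) n u \<in> W) \<Longrightarrow> W = carr V"
    and sugawara: "conf V = scal V (1 / (2 * (of_nat k + 2)))
          (scal V (1/2) (mode V (\<iota> sl2_h) (-1) (\<iota> sl2_h))
           + mode V (\<iota> sl2_e) (-1) (\<iota> sl2_f) + mode V (\<iota> sl2_f) (-1) (\<iota> sl2_e))"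
    and simple: "simple_voa V"

text \<open>\<open>M\<close> is (a copy of) the \<open>L(k,0)\<close>-module \<open>L(k,i)\<close>, and \<open>v j\<close> is \<open>v\<^bsup>i,j\<^esup>\<close>, for \<open>j \<le> i\<close>.\<close>

locale affine_sl2_irreducible =
  simple_affine_sl2_voa V k \<iota>
  for V :: "('v::ab_group_add) voa" and k :: nat and \<iota> :: "mat2 \<Rightarrow> 'v" +
  fixes i :: nat and M :: "('v, 'm::ab_group_add) voa_mod" and v :: "nat \<Rightarrow> 'm"
  assumes irreducible: "irreducible_module V M"
    and v_independent: "inj_on v {..i}" "\<not> module.dependent (scal M) (v ` {..i})"
    and v_span: "\<exists>l. is_lowest_weight V M l \<and>
          weight_space V M l = module.span (scal M) (v ` {..i})"
    and h0: "j \<le> i \<Longrightarrow> act M (\<iota> sl2_h) 0 (v j) = scal M (of_nat i - 2 * of_nat j) (v j)"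
    and e0_top: "act M (\<iota> sl2_e) 0 (v 0) = 0"
    and e0: "1 \<le> j \<Longrightarrow> j \<le> i \<Longrightarrow>
          act M (\<iota> sl2_e) 0 (v j) = scal M (of_nat (i - j + 1)) (v (j - 1))"
    and f0_bot: "act M (\<iota> sl2_f) 0 (v i) = 0"
    and f0: "j < i \<Longrightarrow> act M (\<iota> sl2_f) 0 (v j) = scal M (of_nat (j + 1)) (v (j + 1))"
    and annihilation: "a \<in> {sl2_h, sl2_e, sl2_f} \<Longrightarrow> n \<ge> 1 \<Longrightarrow> j \<le> i \<Longrightarrow>
          act M (\<iota> a) n (v j) = 0"

end

theory Submission
  imports Defs
begin

text \<open>
  The automorphism is \<open>exp (\<pi> \<i> h(0) / 3)\<close>: the modes of \<open>h\<close>, \<open>e\<close>, \<open>f\<close> shift \<open>h(0)\<close>-eigenvalues by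
  \<open>0\<close>, \<open>2\<close>, \<open>-2\<close>, and \<open>\<sigma>\<close> multiplies these three vectors by \<open>1\<close>, \<open>\<omega>\<close>, \<open>\<omega>\<^sup>2\<close> for a primitive cube root of
  unity \<open>\<omega>\<close>.  So \<open>V\<close> is the sum of three parts \<open>V\<^sup>0, V\<^sup>1, V\<^sup>2\<close>, where \<open>\<sigma>\<close> acts on \<open>V\<^sup>r\<close> by \<open>\<omega>\<^sup>r\<close> and the modes of
  \<open>V\<^sup>r\<close> raise \<open>h(0)\<close>-eigenvalues by \<open>2 r\<close> modulo \<open>6\<close> (\<open>\<sigma>_components_span\<close>); the fixed points are \<open>V\<^sup>0\<close>.
  On \<open>M\<close> all eigenvalues of \<open>h(0)\<close> have the form \<open>2 t - i\<close>, and the summands are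
  the three sums \<open>h_class s\<close> of the eigenspaces with \<open>t\<close> congruent to \<open>s\<close> modulo \<open>3\<close>.

  Irreducibility is the argument of Dong and Mason in quantum Galois theory.  For any subspace \<open>N\<close>, the
  vectors \<open>u\<^sub>n w\<close> with \<open>u\<close> in \<open>V\<close> and \<open>w\<close> in \<open>N\<close> span a \<open>V\<close>-submodule (\<open>span_of_actions_submodule\<close>), which is
  all of \<open>M\<close> when \<open>N\<close> is nonzero.  If \<open>N\<close> lies in \<open>h_class s\<close> and is stable under \<open>V\<^sup>0\<close>, then \<open>V\<^sup>1\<close>
  and \<open>V\<^sup>2\<close> map \<open>N\<close> into the other two classes, so the part of \<open>M\<close> in \<open>h_class s\<close> comes from
  \<open>V\<^sup>0\<close> alone and equals \<open>N\<close> (\<open>fixed_point_submodule_of_h_class\<close>).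

  It remains to find the lowest weights.  The Sugawara vector gives the weight of the top
  level, and \<open>v i, v (i - 1), v (i - 2)\<close> lie in the classes \<open>0, 1, 2\<close>; this settles \<open>i > 1\<close>.  For \<open>i = 1\<close>
  the top level misses class \<open>2\<close>.  The vector \<open>f(-n) v 1\<close> is in that class, and
  \<open>e(n) f(-n) v 1 = (n k - 1) v 1\<close> shows that it is nonzero unless \<open>n = k = 1\<close>.  In that exceptional case
  \<open>f(-1) v 1\<close> and \<open>e(-1) v 0\<close> are singular, hence zero, so degree one misses
  class \<open>2\<close> as well and \<open>n = 2\<close> is the first degree in which it occurs.
\<close>

section \<open>Sums of eigenvectors\<close>

context vector_space
begin

text \<open>
  Collecting the terms of a linear combination by summand leaves one vector for each index.
\<close>

lemma span_UN_subspaces_sum: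
  assumes sub: "\<And>i. i \<in> I \<Longrightarrow> subspace (E i)" and w: "w \<in> span (\<Union>i\<in>I. E i)"
  obtains S x where "finite S" "S \<subseteq> I" "\<And>i. i \<in> S \<Longrightarrow> x i \<in> E i" "w = sum x S"
proof -
  have "\<exists>S x. finite S \<and> S \<subseteq> I \<and> (\<forall>i\<in>S. x i \<in> E i) \<and> w = sum x S"
    using w
  proof (induction rule: span_induct_alt)
    case base
    show ?case by (intro exI[of _ "{}"]) auto
  next
    case (step c y z)
    then obtain j S x where j: "j \<in> I" "y \<in> E j"
      and S: "finite S" "S \<subseteq> I" "\<forall>i\<in>S. x i \<in> E i" "z = sum x S" by blast
    have cy: "scale c y \<in> E j" using j sub subspace_scale by blast
    show ?case
    proof (cases "j \<in> S")
      case True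
      let ?x = "x(j := scale c y + x j)"
      have "sum ?x S = scale c y + z"
        using True S by (simp add: sum.remove[of S j] algebra_simps)
      moreover have "\<forall>i\<in>S. ?x i \<in> E i"
        using True S cy j sub[of j] subspace_add by auto
      ultimately show ?thesis using S by metis
    next
      case False
      let ?x = "x(j := scale c y)"
      have "sum ?x S = sum x S" using False by (intro sum.cong) auto
      then have "sum ?x (insert j S) = scale c y + z"
        using False S by simp
      moreover have "\<forall>i\<in>insert j S. ?x i \<in> E i"
        using S cy by auto
      moreover have "finite (insert j S)" "insert j S \<subseteq> I" using S j by auto
      ultimately show ?thesis by metis
    qed
  qed
  then show ?thesis using that by blast
qed

text \<open>
  Applying \<open>T - ev t\<close> to the sum kills the component for \<open>t\<close> and rescales the others by nonzero
  factors, so the components can be peeled off one at a time.  With \<open>N = {0}\<close> this is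
  the independence of eigenspaces; for larger \<open>N\<close> it shows that a stable subspace
  inherits an eigenspace decomposition.  The operator is linear only on the carrier \<open>C\<close>.
\<close>

lemma eigenvector_components_in_stable_subspace:
  assumes C: "subspace C"
    and add: "\<And>x y. x \<in> C \<Longrightarrow> y \<in> C \<Longrightarrow> T (x + y) = T x + T y"
    and scale: "\<And>c x. x \<in> C \<Longrightarrow> T (scale c x) = scale c (T x)"
    and N: "subspace N" and stable: "\<And>x. x \<in> N \<Longrightarrow> T x \<in> N"
    and S: "finite S" "inj_on ev S"
    and eig: "\<And>t. t \<in> S \<Longrightarrow> x t \<in> C \<and> T (x t) = scale (ev t) (x t)"
    and sum: "sum x S \<in> N"
  shows "\<forall>t\<in>S. x t \<in> N"
  using S eig sum
proof (induction S arbitrary: x rule: finite_induct)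
  case empty
  then show ?case by simp
next
  case (insert t S)
  have T0: "T 0 = 0" using scale[of 0 0] subspace_0[OF C] by simp
  have Tsum: "T (sum x A) = (\<Sum>s\<in>A. scale (ev s) (x s))" if "finite A" "A \<subseteq> insert t S" for A
    using that
  proof (induction A rule: finite_induct)
    case (insert s A)
    have "sum x A \<in> C" using insert insert.prems \<open>\<And>t'. t' \<in> Set.insert t S \<Longrightarrow> _\<close> subspace_sum[OF C]
      by (meson insert_subset subset_iff)
    then show ?case using insert \<open>\<And>t'. t' \<in> Set.insert t S \<Longrightarrow> _\<close> add by auto
  qed (simp add: T0)
  let ?y = "\<lambda>s. scale (ev s - ev t) (x s)"
  have "T (sum x (Set.insert t S)) - scale (ev t) (sum x (Set.insert t S)) = sum ?y S"
    using insert by (subst Tsum)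
      (auto simp: scale_sum_right scale_right_distrib scale_left_diff_distrib sum_subtractf)
  then have "sum ?y S \<in> N"
    using insert.prems(3) stable subspace_diff[OF N] subspace_scale[OF N] by metis
  moreover have "?y s \<in> C \<and> T (?y s) = scale (ev s) (?y s)" if "s \<in> S" for s
    using insert.prems(2)[of s] that scale subspace_scale[OF C] by (auto simp: mult.commute)
  ultimately have y: "\<forall>s\<in>S. ?y s \<in> N"
    using insert.IH[of ?y] insert.prems(1) by auto
  have xS: "x s \<in> N" if "s \<in> S" for s
  proof -
    have "ev s - ev t \<noteq> 0"
      using inj_onD[OF insert.prems(1), of s t] insert.hyps that by auto
    then have "x s = scale (inverse (ev s - ev t)) (?y s)" by simp
    then show ?thesis using y that subspace_scale[OF N] by metis
  qed
  moreover have "x t = sum x (Set.insert t S) - sum x S" using insert.hyps by simp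
  then have "x t \<in> N"
    using insert.prems(3) subspace_diff[OF N] subspace_sum[OF N] xS by metis
  ultimately show ?case by auto
qed

lemma span_eigenspaces_disjoint:
  assumes C: "subspace C"
    and add: "\<And>x y. x \<in> C \<Longrightarrow> y \<in> C \<Longrightarrow> T (x + y) = T x + T y"
    and scale: "\<And>c x. x \<in> C \<Longrightarrow> T (scale c x) = scale c (T x)"
    and AB: "A \<inter> B = {}" and inj: "inj_on ev (A \<union> B)"
    and w: "w \<in> span (\<Union>t\<in>A. {x \<in> C. T x = scale (ev t) x})"
           "w \<in> span (\<Union>t\<in>B. {x \<in> C. T x = scale (ev t) x})"
  shows "w = 0"
proof -
  let ?E = "\<lambda>t. {x \<in> C. T x = scale (ev t) x}"
  have T0: "T 0 = 0" using scale[of 0 0] subspace_0[OF C] by simp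
  have sub: "subspace (?E t)" for t
    using T0 subspace_0[OF C] subspace_add[OF C] subspace_scale[OF C] add scale
    by (intro subspaceI) (auto simp: scale_right_distrib mult.commute)
  obtain S x where S: "finite S" "S \<subseteq> A" "\<And>t. t \<in> S \<Longrightarrow> x t \<in> ?E t" "w = sum x S"
    by (rule span_UN_subspaces_sum[OF sub w(1)]) (rule that)
  obtain R y where R: "finite R" "R \<subseteq> B" "\<And>t. t \<in> R \<Longrightarrow> y t \<in> ?E t" "w = sum y R"
    by (rule span_UN_subspaces_sum[OF sub w(2)]) (rule that)
  let ?z = "\<lambda>t. if t \<in> S then x t else - y t"
  have disj: "S \<inter> R = {}" using S R AB by auto
  have "sum ?z (S \<union> R) = sum ?z S + sum ?z R"
    using S R disj by (intro sum.union_disjoint) auto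
  also have "sum ?z S = w" using S by simp
  also have "sum ?z R = (\<Sum>t\<in>R. - y t)" using disj by (intro sum.cong) auto
  also have "\<dots> = - w" using R by (simp add: sum_negf)
  finally have sum0: "sum ?z (S \<union> R) \<in> {0}" by simp
  have z0: "\<forall>t\<in>S \<union> R. ?z t \<in> {0}"
  proof (rule eigenvector_components_in_stable_subspace[OF C add scale _ _ _ _ _ sum0, of ev])
    show "subspace {0}" by (simp add: subspace_single_0)
    show "finite (S \<union> R)" using S R by simp
    show "inj_on ev (S \<union> R)" using inj S R by (meson Un_mono inj_on_subset)
    fix t assume t: "t \<in> S \<union> R"
    have "- y t \<in> ?E t" if "t \<in> R" using R that subspace_neg[OF sub] by blast
    then have "?z t \<in> ?E t" using S R t by auto
    then show "?z t \<in> C \<and> T (?z t) = scale (ev t) (?z t)" by blast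
  qed (use T0 in auto)
  have "x t = 0" if "t \<in> S" for t
    using bspec[OF z0, of t] that by simp
  then show ?thesis using S by simp
qed

lemma additive_image_span_subset:
  assumes C: "subspace C" "B \<subseteq> C"
    and add: "\<And>x y. x \<in> C \<Longrightarrow> y \<in> C \<Longrightarrow> T (x + y) = T x + T y"
    and scale: "\<And>c x. x \<in> C \<Longrightarrow> T (scale c x) = scale c (T x)"
    and D: "subspace D" and B: "\<And>x. x \<in> B \<Longrightarrow> T x \<in> D" and w: "w \<in> span B"
  shows "T w \<in> D"
proof -
  have "w \<in> C \<and> T w \<in> D"
    using w
  proof (induction rule: span_induct_alt)
    case base
    have "T 0 = 0" using scale[of 0 0] subspace_0[OF C(1)] by simp
    then show ?case using subspace_0[OF C(1)] subspace_0[OF D] by simp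
  next
    case (step c x y)
    then have x: "x \<in> C" using C(2) by auto
    then show ?case
      using step add[of "scale c x" y] scale[of x c] B[of x] subspace_add[OF C(1)]
        subspace_scale[OF C(1)] subspace_add[OF D] subspace_scale[OF D] by auto
  qed
  then show ?thesis ..
qed

end

lemma (in module) Sum_any_in_subspace:
  assumes "subspace S" "\<And>j. f j \<in> S"
  shows "Sum_any f \<in> S"
  using assms by (simp add: Sum_any.expand_set subspace_sum)

lemma Sum_any_eq_sum_lessThan:
  fixes f :: "nat \<Rightarrow> 'a::comm_monoid_add"
  assumes "\<And>j. j \<ge> n \<Longrightarrow> f j = 0"
  shows "Sum_any f = sum f {..<n}"
  by (rule Sum_any.expand_superset) (use assms leI in auto)

lemma gchoose_0_left: "(0 :: complex) gchoose j = (if j = 0 then 1 else 0)"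
  by (cases j) auto

section \<open>Consequences of the Borcherds identity\<close>

context weak_module
begin

lemma act_zero_right [simp]: "a \<in> carr V \<Longrightarrow> act M a n 0 = 0"
  using act_scal_right[of a 0 n 0] M.subspace_0[OF M_subspace] by simp

lemma act_zero_left [simp]: "w \<in> carr M \<Longrightarrow> act M 0 n w = 0"
  using act_scal_left[of 0 w 0 n] V.subspace_0[OF V_subspace] by simp

lemma act_span:
  assumes "a \<in> carr V" "B \<subseteq> carr M" "M.subspace D"
    and "\<And>x. x \<in> B \<Longrightarrow> act M a n x \<in> D" and "w \<in> M.span B"
  shows "act M a n w \<in> D"
  using M.additive_image_span_subset[OF M_subspace assms(2), of "act M a n" D]
    act_add_right act_scal_right assms by blast

lemma act_span_left:
  assumes "w \<in> carr M" "B \<subseteq> carr V" "M.subspace D"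
    and x: "\<And>x. x \<in> B \<Longrightarrow> act M x n w \<in> D" and u: "u \<in> V.span B"
  shows "act M u n w \<in> D"
proof -
  have "u \<in> carr V \<and> act M u n w \<in> D"
    using u
  proof (induction rule: V.span_induct_alt)
    case base
    then show ?case
      using assms V.subspace_0[OF V_subspace] M.subspace_0 by simp
  next
    case (step c x y)
    have "x \<in> carr V" using step assms by blast
    then show ?case
      using step assms(1,3) x[OF step(1)] V.subspace_scale[OF V_subspace]
      by (simp add: act_add_left act_scal_left V.subspace_add[OF V_subspace]
          M.subspace_add M.subspace_scale)
  qed
  then show ?thesis ..
qed

text \<open>
  The Borcherds identity with \<open>p = 0\<close>: its left side has a single term, so it expresses
  modes of \<open>a\<^sub>r b\<close> through products of modes of \<open>a\<close> and \<open>b\<close>.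
\<close>

lemma iterate_formula:
  assumes "a \<in> carr V" "b \<in> carr V" "w \<in> carr M"
  shows "act M (mode V a r b) q w = Sum_any (\<lambda>j::nat. scal M ((-1) ^ j * (of_int r gchoose j))
      (act M a (r - int j) (act M b (q + int j) w)
       - scal M ((-1) powi r) (act M b (q + r - int j) (act M a (int j) w))))"
proof -
  have "Sum_any (\<lambda>j::nat. scal M (of_int 0 gchoose j)
      (act M (mode V a (r + int j) b) (0 + q - int j) w)) = act M (mode V a r b) q w"
    by (subst Sum_any_eq_sum_lessThan[of 1]) (auto simp: gchoose_0_left)
  then show ?thesis
    using borcherds[OF assms, of 0 r q] by simp
qed

lemma iterate_in_subspace:
  assumes "a \<in> carr V" "b \<in> carr V" "w \<in> carr M" and D: "M.subspace D"
    and "\<And>j::nat. act M a (r - int j) (act M b (q + int j) w) \<in> D"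
    and "\<And>j::nat. act M b (q + r - int j) (act M a (int j) w) \<in> D"
  shows "act M (mode V a r b) q w \<in> D"
  unfolding iterate_formula[OF assms(1-3)]
  using assms(5,6) M.subspace_diff[OF D] M.subspace_scale[OF D]
  by (intro M.Sum_any_in_subspace[OF D]) blast

text \<open>
  The Borcherds identity with \<open>r = 0\<close>, where the right side has a single term.
\<close>

lemma commutator_formula:
  assumes "a \<in> carr V" "b \<in> carr V" "w \<in> carr M"
  shows "act M a m (act M b n w) - act M b n (act M a m w)
    = Sum_any (\<lambda>j::nat. scal M (of_int m gchoose j) (act M (mode V a (int j) b) (m + n - int j) w))"
proof -
  have "Sum_any (\<lambda>j::nat. scal M ((-1) ^ j * (of_int 0 gchoose j))
              (act M a (m + 0 - int j) (act M b (n + int j) w)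
               - scal M ((-1) powi 0) (act M b (n + 0 - int j) (act M a (m + int j) w))))
     = act M a m (act M b n w) - act M b n (act M a m w)"
    by (subst Sum_any_eq_sum_lessThan[of 1]) (auto simp: gchoose_0_left)
  then show ?thesis
    using borcherds[OF assms, of m 0 n] by simp
qed

text \<open>
  The Sugawara vector is a combination of vectors \<open>a\<^sub>-\<^sub>1 b\<close>, so this evaluates \<open>L(0)\<close> on vectors of low degree.
\<close>

lemma iterate_minus_one_mode_one:
  assumes ab: "a \<in> carr V" "b \<in> carr V" "w \<in> carr M"
    and ann: "\<And>n. n \<ge> 2 \<Longrightarrow> act M a n w = 0" "\<And>n. n \<ge> 2 \<Longrightarrow> act M b n w = 0"
  shows "act M (mode V a (-1) b) 1 w =
    act M a (-1) (act M b 1 w) + act M b 0 (act M a 0 w) + act M b (-1) (act M a 1 w)"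
proof -
  have "act M (mode V a (-1) b) 1 w = sum (\<lambda>j::nat. scal M ((-1) ^ j * (of_int (-1) gchoose j))
      (act M a (-1 - int j) (act M b (1 + int j) w)
       - scal M ((-1) powi (-1)) (act M b (1 + -1 - int j) (act M a (int j) w)))) {..<2}"
    unfolding iterate_formula[OF ab]
    by (rule Sum_any_eq_sum_lessThan) (use ab ann in auto)
  also have "\<dots> = act M a (-1) (act M b 1 w) + act M b 0 (act M a 0 w) + act M b (-1) (act M a 1 w)"
    using ab ann by (simp add: numeral_2_eq_2)
  finally show ?thesis .
qed

text \<open>
  Since \<open>L(-1) a = a\<^sub>-\<^sub>2 \<one>\<close>, this is the \<open>L(-1)\<close>-derivative property on a module.  It follows from
  the iterate formula with \<open>b = \<one>\<close>, because only one mode of the vacuum acts as a nonzero operator.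
\<close>

lemma act_creation_minus_two:
  assumes a: "a \<in> carr V" and w: "w \<in> carr M"
  shows "act M (mode V a (-2) (vac V)) q w = scal M (- of_int q) (act M a (q - 1) w)"
proof -
  \<comment> \<open>The unique index at which a term of the iterate formula can survive, for either sign of \<open>q\<close>.\<close>
  define j0 where "j0 = nat (if q \<le> -1 then -1 - q else q - 1)"
  define g where "g = (\<lambda>j::nat. scal M ((-1) ^ j * (of_int (-2) gchoose j))
      (act M a (-2 - int j) (act M (vac V) (q + int j) w)
       - scal M ((-1) powi (-2)) (act M (vac V) (q + -2 - int j) (act M a (int j) w))))"
  \<comment> \<open>The coefficients of \<open>(1 - x)\<^bsup>-2\<^esup>\<close>.\<close>
  have coeff: "(-1) ^ j * (of_int (-2) gchoose j) = (of_nat j + 1 :: complex)" for j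
  proof -
    have "(of_int (-2) gchoose j :: complex) = (-1) ^ j * (of_nat (Suc j) gchoose j)"
      using gbinomial_minus[of "2::complex" j] by (simp add: add.commute)
    also have "(of_nat (Suc j) gchoose j :: complex) = of_nat (Suc j choose j)"
      by (rule binomial_gbinomial[symmetric])
    also have "Suc j choose j = Suc j" by (rule binomial_Suc_n)
    finally show ?thesis
      by (simp add: mult.assoc[symmetric] power_mult_distrib[symmetric])
  qed
  have vac: "act M (vac V) n x = (if n = -1 then x else 0)" if "x \<in> carr M" for n x
    using act_vac that by simp
  have g: "g j = scal M (of_nat j + 1)
      ((if q + int j = -1 then act M a (-2 - int j) w else 0)
       - (if q - int j = 1 then act M a (int j) w else 0))" for j
    unfolding g_def coeff
    by (subst (1 2) vac) (use a w act_closed in auto)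
  have "act M (mode V a (-2) (vac V)) q w = Sum_any g"
    unfolding iterate_formula[OF a vac_in w] g_def ..
  also have "\<dots> = sum g {j0}"
    by (rule Sum_any.expand_superset) (auto simp: g j0_def split: if_splits)
  also have "\<dots> = scal M (- of_int q) (act M a (q - 1) w)"
    by (cases "q = 0") (auto simp: g j0_def of_nat_nat algebra_simps)
  finally show ?thesis .
qed

text \<open>
  Products of two modes applied to a vector of \<open>N\<close> reduce to single modes.  Choose \<open>p\<close> in the Borcherds
  identity so large that \<open>a\<^sub>p\<close> and all later modes of \<open>a\<close> kill \<open>w\<close>.  Then its left side lies in the span, and its
  right side is \<open>a\<^sub>m b\<^sub>n w\<close> plus multiples of \<open>a\<^bsub>m-j\<^esub> b\<^bsub>n+j\<^esub> w\<close> with \<open>j > 0\<close>, which are treated by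
  induction because \<open>b\<^sub>n w = 0\<close> for large \<open>n\<close>.
\<close>

lemma span_of_actions_submodule:
  assumes N: "N \<subseteq> carr M"
  shows "submodule V M (M.span {act M u n w | u n w. u \<in> carr V \<and> w \<in> N})"
    (is "submodule V M (M.span ?B)")
proof -
  have B: "?B \<subseteq> carr M" using N act_closed by blast
  have gen: "act M a m (act M b n w) \<in> M.span ?B"
    if a: "a \<in> carr V" and b: "b \<in> carr V" and wN: "w \<in> N" for a b m n w
  proof -
    have w: "w \<in> carr M" using wN N by blast
    obtain P where P: "\<And>j. j \<ge> P \<Longrightarrow> act M a j w = 0" using truncation[OF a w] by blast
    obtain Q where Q: "\<And>j. j \<ge> Q \<Longrightarrow> act M b j w = 0" using truncation[OF b w] by blast
    show ?thesis
    proof (induction "nat (Q - n)" arbitrary: m n rule: less_induct)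
      case less
      show ?case
      proof (cases "n \<ge> Q")
        case True
        then show ?thesis using Q a M.span_zero by simp
      next
        case False
        define F where "F = (\<lambda>j::nat. scal M ((-1) ^ j * (of_int (m - P) gchoose j))
              (act M a (P + (m - P) - int j) (act M b (n + int j) w)
               - scal M ((-1) powi (m - P)) (act M b (n + (m - P) - int j) (act M a (P + int j) w))))"
        define K where "K = Suc (nat (Q - n))"
        have F: "F j = scal M ((-1) ^ j * (of_int (m - P) gchoose j))
              (act M a (m - int j) (act M b (n + int j) w))" for j
          unfolding F_def using b by (simp add: P)
        have F_in: "F j \<in> M.span ?B" if "j \<noteq> 0" for j
          unfolding F
          by (rule M.span_scale, rule less.hyps) (use False that in linarith)
        have "F j = 0" if "j \<ge> K" for j
          using that a Q[of "n + int j"] by (simp add: F K_def)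
        then have "Sum_any F = sum F {..<K}"
          by (rule Sum_any_eq_sum_lessThan)
        also have "\<dots> = F 0 + sum F ({..<K} - {0})"
          by (rule sum.remove) (auto simp: K_def)
        also have "F 0 = act M a m (act M b n w)" by (simp add: F)
        finally have "act M a m (act M b n w) = Sum_any F - sum F ({..<K} - {0})"
          by simp
        moreover have "Sum_any F \<in> M.span ?B"
          unfolding F_def borcherds[OF a b w, symmetric]
        proof (rule M.Sum_any_in_subspace[OF M.subspace_span])
          fix j :: nat
          have "mode V a (m - P + int j) b \<in> carr V" using mode_closed a b by simp
          then have "act M (mode V a (m - P + int j) b) (P + n - int j) w \<in> ?B" using wN by blast
          then show "scal M (of_int P gchoose j)
              (act M (mode V a (m - P + int j) b) (P + n - int j) w) \<in> M.span ?B"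
            by (intro M.span_scale M.span_base)
        qed
        moreover have "sum F ({..<K} - {0}) \<in> M.span ?B"
          by (rule M.span_sum) (use F_in in blast)
        ultimately show ?thesis by (simp add: M.span_diff)
      qed
    qed
  qed
  have "act M a m x \<in> M.span ?B" if a: "a \<in> carr V" and x: "x \<in> M.span ?B" for a m x
  proof (rule act_span[OF a B M.subspace_span _ x])
    fix y assume "y \<in> ?B"
    then show "act M a m y \<in> M.span ?B" using gen[OF a] by blast
  qed
  moreover have "M.span ?B \<subseteq> carr M"
    using M.span_minimal[OF B M_subspace] .
  ultimately show ?thesis
    unfolding submodule_def by (intro conjI ballI allI M.subspace_span)
qed

lemma restrict_weak_module:
  assumes C: "V.subspace C" "C \<subseteq> carr V" "vac V \<in> C"
      "\<And>a b n. a \<in> C \<Longrightarrow> b \<in> C \<Longrightarrow> mode V a n b \<in> C"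
    and N: "M.subspace N" "N \<subseteq> carr M"
      "\<And>a n w. a \<in> C \<Longrightarrow> w \<in> N \<Longrightarrow> act M a n w \<in> N"
  shows "weak_module (V\<lparr>carr := C\<rparr>) (M\<lparr>carr := N\<rparr>)"
proof -
  have C': "a \<in> carr V" if "a \<in> C" for a using that C by blast
  have N': "w \<in> carr M" if "w \<in> N" for w using that N by blast
  show ?thesis
  proof (intro weak_module.intro weak_module_axioms.intro, goal_cases)
    case 1 show ?case by (simp add: V.vector_space_axioms)
  next
    case 2 show ?case by (simp add: M.vector_space_axioms)
  next
    case 3 then show ?case using C by simp
  next
    case 4 then show ?case using N by simp
  next
    case 5 then show ?case using C by simp
  next
    case 6 then show ?case using C by simp
  next
    case 7 then show ?case using C' mode_truncation by simp
  next
    case 8 then show ?case using N by simp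
  next
    case 9 then show ?case using C' N' act_add_left by simp
  next
    case 10 then show ?case using C' N' act_scal_left by simp
  next
    case 11 then show ?case using C' N' act_add_right by simp
  next
    case 12 then show ?case using C' N' act_scal_right by simp
  next
    case 13 then show ?case using C' N' truncation by simp
  next
    case 14 then show ?case using N' act_vac by simp
  next
    case 15 then show ?case using C' N' borcherds by simp
  qed
qed

end

section \<open>Restriction to subalgebras and subspaces\<close>

lemma finite_dim_subset: "finite_dim s W \<Longrightarrow> U \<subseteq> W \<Longrightarrow> finite_dim s U"
  unfolding finite_dim_def by blast

lemma weight_space_restrict:
  "N \<subseteq> carr M \<Longrightarrow> weight_space (V\<lparr>carr := C\<rparr>) (M\<lparr>carr := N\<rparr>) l = weight_space V M l \<inter> N"
  by (auto simp: weight_space_def)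

text \<open>
  A subspace stable under \<open>L(0)\<close> contains the weight components of its vectors.
\<close>

lemma (in weak_module) restrict_grading:
  assumes conf: "conf V \<in> carr V"
    and grad: "internal_direct_sum (scal M) (carr M) I (\<lambda>t. weight_space V M (ev t))"
    and inj: "inj_on ev I"
    and N: "M.subspace N" "N \<subseteq> carr M" "\<And>w. w \<in> N \<Longrightarrow> act M (conf V) 1 w \<in> N"
  shows "internal_direct_sum (scal M) N I (\<lambda>t. weight_space V M (ev t) \<inter> N)"
proof -
  have W: "M.subspace (weight_space V M (ev t))" if "t \<in> I" for t
    using grad that by (simp add: internal_direct_sum_def)
  have WN: "M.subspace (weight_space V M (ev t) \<inter> N)" if "t \<in> I" for t
    using W[OF that] N(1) by (rule M.subspace_inter)
  have "N \<subseteq> M.span (\<Union>t\<in>I. weight_space V M (ev t) \<inter> N)"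
  proof
    fix w assume w: "w \<in> N"
    then have wI: "w \<in> M.span (\<Union>t\<in>I. weight_space V M (ev t))"
      using N grad by (auto simp: internal_direct_sum_def)
    obtain S x where S: "finite S" "S \<subseteq> I" "\<And>t. t \<in> S \<Longrightarrow> x t \<in> weight_space V M (ev t)" "w = sum x S"
      by (rule M.span_UN_subspaces_sum[OF W wI]) (assumption, rule that)
    have "\<forall>t\<in>S. x t \<in> N"
    proof (rule M.eigenvector_components_in_stable_subspace[OF M_subspace _ _ N(1) N(3) S(1), where ev = ev])
      show "inj_on ev S" using inj S(2) by (rule inj_on_subset)
      show "x t \<in> carr M \<and> act M (conf V) 1 (x t) = scal M (ev t) (x t)" if "t \<in> S" for t
        using S(3) that by (simp add: weight_space_def)
      show "sum x S \<in> N" using w S(4) by simp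
    qed (simp_all add: act_add_right act_scal_right conf)
    then have "x t \<in> (\<Union>t\<in>I. weight_space V M (ev t) \<inter> N)" if "t \<in> S" for t
      using S(2,3) that by blast
    then show "w \<in> M.span (\<Union>t\<in>I. weight_space V M (ev t) \<inter> N)"
      unfolding S(4) by (intro M.span_sum M.span_base)
  qed
  moreover have "M.span (\<Union>t\<in>I. weight_space V M (ev t) \<inter> N) \<subseteq> N"
    by (rule M.span_minimal[OF _ N(1)]) blast
  moreover have "weight_space V M (ev t) \<inter> N \<inter> M.span (\<Union>j\<in>I - {t}. weight_space V M (ev j) \<inter> N) = {0}"
    if t: "t \<in> I" for t
  proof -
    have "M.span (\<Union>j\<in>I - {t}. weight_space V M (ev j) \<inter> N)
        \<subseteq> M.span (\<Union>j\<in>I - {t}. weight_space V M (ev j))"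
      by (intro M.span_mono) blast
    moreover have "weight_space V M (ev t) \<inter> M.span (\<Union>j\<in>I - {t}. weight_space V M (ev j)) = {0}"
      using grad t by (simp add: internal_direct_sum_def)
    moreover have "0 \<in> weight_space V M (ev t) \<inter> N"
      using M.subspace_0[OF WN[OF t]] .
    moreover have "0 \<in> M.span (\<Union>j\<in>I - {t}. weight_space V M (ev j) \<inter> N)"
      by (rule M.span_zero)
    ultimately show ?thesis by blast
  qed
  ultimately show ?thesis
    unfolding internal_direct_sum_def using WN by (intro conjI ballI) simp_all
qed

lemma (in vertex_operator_algebra) restrict_voa:
  assumes C: "V.subspace C" "C \<subseteq> carr V" "vac V \<in> C" "conf V \<in> C"
      "\<And>a b n. a \<in> C \<Longrightarrow> b \<in> C \<Longrightarrow> mode V a n b \<in> C"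
  shows "vertex_operator_algebra (V\<lparr>carr := C\<rparr>)"
proof -
  have ad: "adjoint_module (V\<lparr>carr := C\<rparr>) = adjoint_module V\<lparr>carr := C\<rparr>"
    by (simp add: adjoint_module_def)
  have C': "a \<in> carr V" if "a \<in> C" for a using that C by blast
  have W: "weight_space (V\<lparr>carr := C\<rparr>) (adjoint_module (V\<lparr>carr := C\<rparr>)) l
      = weight_space V (adjoint_module V) l \<inter> C" for l
    unfolding ad using C by (intro weight_space_restrict) (simp add: adjoint_module_def)
  interpret R: weak_module "V\<lparr>carr := C\<rparr>" "adjoint_module (V\<lparr>carr := C\<rparr>)"
    unfolding ad
    by (rule restrict_weak_module) (use C in \<open>auto simp: adjoint_module_def\<close>)
  show ?thesis
  proof (intro vertex_operator_algebra.intro vertex_operator_algebra_axioms.intro R.weak_module_axioms,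
      goal_cases)
    case (1 a) then show ?case using creation C' by simp
  next
    case (2 a n) then show ?case using creation_nonneg C' by simp
  next
    case 3 then show ?case using C by simp
  next
    case 4
    from virasoro obtain c where c: "\<forall>m n. \<forall>a\<in>carr V.
          mode V (conf V) (m + 1) (mode V (conf V) (n + 1) a)
          - mode V (conf V) (n + 1) (mode V (conf V) (m + 1) a)
        = scal V (of_int (m - n)) (mode V (conf V) (m + n + 1) a)
          + (if m + n = 0 then scal V (of_int (m ^ 3 - m) / 12 * c) a else 0)" by blast
    show ?case by (rule exI[of _ c]) (use c C' in simp)
  next
    case (5 a b n) then show ?case using translation C' by simp
  next
    case 6
    have "internal_direct_sum (scal (adjoint_module V)) C UNIV
        (\<lambda>n::int. weight_space V (adjoint_module V) (of_int n) \<inter> C)"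
      by (rule restrict_grading)
        (use C conf_in grading in \<open>auto simp: adjoint_module_def inj_on_def\<close>)
    then show ?case unfolding W by (simp add: adjoint_module_def)
  next
    case (7 n)
    have "finite_dim (scal V) (weight_space V (adjoint_module V) (of_int n) \<inter> C)"
      using weight_finite_dim[of n] by (rule finite_dim_subset) simp
    then show ?case by (simp add: W)
  next
    case 8
    from weight_bounded obtain K :: int where "\<forall>n<K. weight_space V (adjoint_module V) (of_int n) = {0}"
      by blast
    then have "\<forall>n<K. weight_space V (adjoint_module V) (of_int n) \<inter> C = {0}"
      using V.subspace_0[OF C(1)] by blast
    then show ?case unfolding W by blast
  qed
qed

lemma (in voa_module) restrict_voa_module:
  assumes C: "voa.V.subspace C" "C \<subseteq> carr V" "vac V \<in> C" "conf V \<in> C"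
      "\<And>a b n. a \<in> C \<Longrightarrow> b \<in> C \<Longrightarrow> mode V a n b \<in> C"
    and N: "M.subspace N" "N \<subseteq> carr M"
      "\<And>a n w. a \<in> C \<Longrightarrow> w \<in> N \<Longrightarrow> act M a n w \<in> N"
  shows "voa_module (V\<lparr>carr := C\<rparr>) (M\<lparr>carr := N\<rparr>)"
proof -
  interpret V': vertex_operator_algebra "V\<lparr>carr := C\<rparr>"
    by (rule voa.restrict_voa) (use C in auto)
  interpret R: weak_module "V\<lparr>carr := C\<rparr>" "M\<lparr>carr := N\<rparr>"
    by (rule restrict_weak_module) (use C N in auto)
  show ?thesis
  proof (intro voa_module.intro voa_module_axioms.intro V'.vertex_operator_algebra_axioms
      R.weak_module_axioms, goal_cases)
    case 1
    have "internal_direct_sum (scal M) N UNIV (\<lambda>l. weight_space V M l \<inter> N)"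
      by (rule restrict_grading[where ev = "\<lambda>l. l"]) (use C N voa.conf_in mod_grading in auto)
    moreover have "weight_space (V\<lparr>carr := C\<rparr>) (M\<lparr>carr := N\<rparr>) = (\<lambda>l. weight_space V M l \<inter> N)"
      by (rule ext) (rule weight_space_restrict[OF N(2)])
    ultimately show ?case by simp
  next
    case (2 l)
    have "finite_dim (scal M) (weight_space V M l \<inter> N)"
      using mod_weight_finite_dim[of l] by (rule finite_dim_subset) simp
    then show ?case by (simp add: weight_space_restrict[OF N(2)])
  next
    case (3 l)
    from mod_weight_bounded[of l] obtain K :: int
      where "\<forall>n<K. weight_space V M (l + of_int n) = {0}" by blast
    then have "\<forall>n<K. weight_space V M (l + of_int n) \<inter> N = {0}"
      using M.subspace_0[OF N(1)] by blast
    then show ?case unfolding weight_space_restrict[OF N(2)] by blast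
  qed
qed

lemma (in weak_module) weight_space_span_disjoint:
  assumes "conf V \<in> carr V" "w \<in> weight_space V M l"
    "w \<in> M.span (\<Union>l'\<in>L. weight_space V M l')" "l \<notin> L"
  shows "w = 0"
  using assms
  by (intro M.span_eigenspaces_disjoint[OF M_subspace, of "act M (conf V) 1" "{l}" L "\<lambda>x. x"])
    (auto simp: act_add_right act_scal_right weight_space_def intro: M.span_base)

section \<open>Affine modes\<close>

lemma bracket_in_sl2: "bracket a b \<in> sl2"
  using trace_mul_sym[of a b] by (simp add: bracket_def sl2_def trace_sub)

lemma mscale_in_sl2: "a \<in> sl2 \<Longrightarrow> mscale x a \<in> sl2"
proof -
  assume "a \<in> sl2"
  then have "a $ 1 $ 1 + a $ 2 $ 2 = 0" by (simp add: sl2_def trace_def sum_2)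
  then have "x * (a $ 1 $ 1 + a $ 2 $ 2) = 0" by simp
  then show ?thesis by (simp add: sl2_def trace_def mscale_def sum_2 distrib_left)
qed

lemma add_in_sl2: "a \<in> sl2 \<Longrightarrow> b \<in> sl2 \<Longrightarrow> a + b \<in> sl2"
  by (simp add: sl2_def trace_add)

lemma sl2_basis_expansion:
  assumes "a \<in> sl2"
  shows "a = mscale (a $ 1 $ 1) sl2_h + mscale (a $ 1 $ 2) sl2_e + mscale (a $ 2 $ 1) sl2_f"
proof -
  have "a $ 1 $ 1 + a $ 2 $ 2 = 0"
    using assms by (simp add: sl2_def trace_def sum_2)
  then have "a $ 2 $ 2 = - a $ 1 $ 1"
    by (simp only: add_eq_0_iff)
  then show ?thesis
    by (simp add: mscale_def sl2_h_def sl2_e_def sl2_f_def vec_eq_iff forall_2)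
qed

text \<open>
  Summed over the dual bases \<open>h, e, f\<close> and \<open>h/2, f, e\<close>, the two trace terms contribute \<open>2 k c\<close>, and the
  Casimir element contributes \<open>4 c\<close>, its eigenvalue on the adjoint representation; this is where
  the normalisation \<open>1 / (2 (k + 2))\<close> of the Sugawara vector comes from.
\<close>

lemma sl2_casimir_identity:
  fixes k :: complex
  defines "X \<equiv> (\<lambda>a b c. mscale (trace (b ** c) * k) a + bracket b (bracket a c)
      + mscale (trace (a ** c) * k) b)"
  assumes "c \<in> sl2"
  shows "mscale (1/2) (X sl2_h sl2_h c) + X sl2_e sl2_f c + X sl2_f sl2_e c
    = mscale (2 * (k + 2)) c"
proof -
  have "c $ 1 $ 1 + c $ 2 $ 2 = 0"
    using assms by (simp add: sl2_def trace_def sum_2)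
  then have "c $ 2 $ 2 = - c $ 1 $ 1"
    by (simp only: add_eq_0_iff)
  then show ?thesis
    by (simp add: X_def bracket_def mscale_def sl2_h_def sl2_e_def sl2_f_def trace_def
        matrix_matrix_mult_def vec_eq_iff forall_2 sum_2 algebra_simps)
qed

text \<open>
  Both sides are the creation of \<open>L(-1) a\<close> from the vacuum.
\<close>

lemma (in vertex_operator_algebra) conf_zero_mode:
  assumes a: "a \<in> carr V"
  shows "mode V (conf V) 0 a = mode V a (-2) (vac V)"
proof -
  have "mode V (conf V) 0 a = mode V (mode V (conf V) 0 a) (-1) (vac V)"
    by (rule creation[OF mode_closed[OF conf_in a], symmetric])
  also have "\<dots> = mode V a (-2) (vac V)"
    using translation[OF a vac_in, of "-1"] by simp
  finally show ?thesis .
qed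

context simple_affine_sl2_voa
begin

lemma mode_zero_right [simp]: "a \<in> carr V \<Longrightarrow> mode V a n 0 = 0"
  using act_zero_right[of a n] by (simp add: adjoint_module_def)

lemma iota_mode_iota:
  assumes a: "a \<in> sl2" and b: "b \<in> sl2" and n: "n \<ge> 0"
  shows "mode V (\<iota> a) n (\<iota> b) =
    (if n = 0 then \<iota> (bracket a b)
     else if n = 1 then scal V (trace (a ** b) * of_nat k) (vac V) else 0)"
proof -
  have "mode V (\<iota> a) n (\<iota> b) = mode V (\<iota> a) n (mode V (\<iota> b) (-1) (vac V))
      - mode V (\<iota> b) (-1) (mode V (\<iota> a) n (vac V))"
    using a b n creation creation_nonneg \<iota>_in by simp
  also have "\<dots> = mode V (\<iota> (bracket a b)) (n - 1) (vac V)
          + (if n = 1 then scal V (trace (a ** b) * of_nat k) (vac V) else 0)"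
    using commutator[OF a b vac_in, of n "-1"] by auto
  finally show ?thesis
    using n creation creation_nonneg \<iota>_in bracket_in_sl2 by auto
qed

text \<open>
  The currents have conformal weight one: in \<open>(a\<^sub>-\<^sub>1 b)\<^sub>1 c\<close> the outer two terms of
  \<open>iterate_minus_one_mode_one\<close> are trace terms and the middle one is a double
  bracket, so the sum is the one in \<open>sl2_casimir_identity\<close>.
\<close>

lemma conf_one_mode_iota:
  assumes c: "c \<in> sl2"
  shows "mode V (conf V) 1 (\<iota> c) = \<iota> c"
proof -
  let ?X = "\<lambda>a b. mscale (trace (b ** c) * of_nat k) a + bracket b (bracket a c)
      + mscale (trace (a ** c) * of_nat k) b"
  have X: "mode V (mode V (\<iota> a) (-1) (\<iota> b)) 1 (\<iota> c) = \<iota> (?X a b)" "?X a b \<in> sl2"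
    if a: "a \<in> sl2" and b: "b \<in> sl2" for a b
  proof -
    have "mode V (mode V (\<iota> a) (-1) (\<iota> b)) 1 (\<iota> c) =
        mode V (\<iota> a) (-1) (mode V (\<iota> b) 1 (\<iota> c)) + mode V (\<iota> b) 0 (mode V (\<iota> a) 0 (\<iota> c))
        + mode V (\<iota> b) (-1) (mode V (\<iota> a) 1 (\<iota> c))"
      using iterate_minus_one_mode_one[of "\<iota> a" "\<iota> b" "\<iota> c"] a b c
      by (simp add: adjoint_module_def \<iota>_in iota_mode_iota)
    moreover have "mode V (\<iota> x) (-1) (scal V s (vac V)) = \<iota> (mscale s x)" if "x \<in> sl2" for x s
      using act_scal_right[of "\<iota> x" "vac V" "-1" s] that
      by (simp add: adjoint_module_def \<iota>_in vac_in creation \<iota>_scal)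
    ultimately show "mode V (mode V (\<iota> a) (-1) (\<iota> b)) 1 (\<iota> c) = \<iota> (?X a b)"
      using a b c by (simp add: iota_mode_iota bracket_in_sl2 \<iota>_add mscale_in_sl2 add_in_sl2)
    show "?X a b \<in> sl2"
      using a b by (intro add_in_sl2 mscale_in_sl2 bracket_in_sl2)
  qed
  have *: "mode V (scal V s (scal V t x + y + z)) 1 (\<iota> c)
      = scal V s (scal V t (mode V x 1 (\<iota> c)) + mode V y 1 (\<iota> c) + mode V z 1 (\<iota> c))"
    if "x \<in> carr V" "y \<in> carr V" "z \<in> carr V" for s t x y z
    using act_add_left act_scal_left that \<iota>_in[OF c] V.subspace_add[OF V_subspace]
      V.subspace_scale[OF V_subspace] by (simp add: adjoint_module_def)
  have "mode V (conf V) 1 (\<iota> c) = scal V (1 / (2 * (of_nat k + 2)))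
      (scal V (1/2) (\<iota> (?X sl2_h sl2_h)) + \<iota> (?X sl2_e sl2_f) + \<iota> (?X sl2_f sl2_e))"
    unfolding sugawara by (subst *) (simp_all add: X sl2_basis_in mode_closed \<iota>_in)
  also have "\<dots> = \<iota> (mscale (1 / (2 * (of_nat k + 2)))
      (mscale (1/2) (?X sl2_h sl2_h) + ?X sl2_e sl2_f + ?X sl2_f sl2_e))"
    by (simp only: X(2) sl2_basis_in \<iota>_add \<iota>_scal mscale_in_sl2 add_in_sl2)
  also have "mscale (1 / (2 * (of_nat k + 2)))
      (mscale (1/2) (?X sl2_h sl2_h) + ?X sl2_e sl2_f + ?X sl2_f sl2_e) = c"
  proof -
    have "of_nat (2 * (k + 2)) \<noteq> (0 :: complex)" unfolding of_nat_eq_0_iff by simp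
    then have "1 / (2 * (of_nat k + 2)) * (2 * (of_nat k + 2)) = (1 :: complex)"
      by (simp add: add.commute)
    moreover have "mscale s (mscale t c) = mscale (s * t) c" "mscale 1 c = c" for s t
      by (simp_all add: mscale_def vec_eq_iff mult.assoc)
    ultimately show ?thesis
      unfolding sl2_casimir_identity[OF c] by metis
  qed
  finally show ?thesis .
qed

end

locale affine_sl2_module =
  simple_affine_sl2_voa V k \<iota> + mod: weak_module V M
  for V :: "('v::ab_group_add) voa" and k :: nat and \<iota> :: "mat2 \<Rightarrow> 'v"
    and M :: "('v, 'm::ab_group_add) voa_mod"
begin

lemma affine_commutator:
  assumes a: "a \<in> sl2" and b: "b \<in> sl2" and w: "w \<in> carr M"
  shows "act M (\<iota> a) m (act M (\<iota> b) n w) = act M (\<iota> b) n (act M (\<iota> a) m w)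
    + act M (\<iota> (bracket a b)) (m + n) w
    + (if m + n = 0 then scal M (of_int m * trace (a ** b) * of_nat k) w else 0)"
proof -
  let ?F = "\<lambda>j::nat. scal M (of_int m gchoose j)
    (act M (mode V (\<iota> a) (int j) (\<iota> b)) (m + n - int j) w)"
  have "Sum_any ?F = sum ?F {..<2}"
    by (rule Sum_any_eq_sum_lessThan) (use a b w in \<open>simp add: iota_mode_iota\<close>)
  also have "\<dots> = act M (\<iota> (bracket a b)) (m + n) w
    + (if m + n = 0 then scal M (of_int m * trace (a ** b) * of_nat k) w else 0)"
    using a b w by (simp add: numeral_2_eq_2 iota_mode_iota mod.act_scal_left vac_in mod.act_vac
        mult.assoc)
  finally show ?thesis
    using mod.commutator_formula[OF \<iota>_in[OF a] \<iota>_in[OF b] w, of m n] by (simp add: algebra_simps)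
qed

text \<open>
  Only \<open>L(-1) a\<close> and \<open>L(0) a\<close> enter the commutator; they contribute \<open>-(n+1) a(n)\<close> and \<open>a(n)\<close>.
\<close>

lemma conf_iota_commutator:
  assumes a: "a \<in> sl2" and w: "w \<in> carr M"
  shows "act M (conf V) 1 (act M (\<iota> a) n w)
    = act M (\<iota> a) n (act M (conf V) 1 w) - scal M (of_int n) (act M (\<iota> a) n w)"
proof -
  let ?F = "\<lambda>j::nat. scal M (of_int 1 gchoose j)
    (act M (mode V (conf V) (int j) (\<iota> a)) (1 + n - int j) w)"
  have "(of_int 1 :: complex) gchoose j = of_nat (1 choose j)" for j
    using binomial_gbinomial[of 1 j, where 'a = complex] by simp
  then have "Sum_any ?F = sum ?F {..<2}"
    by (intro Sum_any_eq_sum_lessThan) simp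
  also have "\<dots> = act M (mode V (conf V) 0 (\<iota> a)) (1 + n) w + act M (\<iota> a) n w"
    using conf_one_mode_iota[OF a] by (simp add: numeral_2_eq_2)
  also have "\<dots> = - scal M (of_int n) (act M (\<iota> a) n w)"
    using a w by (simp add: conf_zero_mode \<iota>_in mod.act_creation_minus_two
        mod.M.scale_left_distrib mod.M.scale_left_diff_distrib)
  finally show ?thesis
    using mod.commutator_formula[OF conf_in \<iota>_in[OF a] w, of 1 n] by (simp add: algebra_simps)
qed

lemma iota_shifts_weight:
  assumes "a \<in> sl2" "w \<in> weight_space V M l"
  shows "act M (\<iota> a) n w \<in> weight_space V M (l - of_int n)"
  using assms conf_iota_commutator[of a w n] mod.act_closed \<iota>_in
  by (simp add: weight_space_def mod.act_scal_right mod.M.scale_left_diff_distrib)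

text \<open>
  By the iterate formula, the elements of \<open>V\<close> all of whose modes preserve \<open>N\<close> are stable under the
  modes of the currents, and these generate \<open>V\<close> from the vacuum.
\<close>

lemma submodule_if_iota_closed:
  assumes N: "N \<subseteq> carr M" "mod.M.subspace N"
    and closed: "\<And>a n w. a \<in> sl2 \<Longrightarrow> w \<in> N \<Longrightarrow> act M (\<iota> a) n w \<in> N"
  shows "submodule V M N"
proof -
  let ?W = "{u \<in> carr V. \<forall>n. \<forall>w\<in>N. act M u n w \<in> N}"
  have N': "w \<in> carr M" if "w \<in> N" for w using that N by blast
  have "?W = carr V"
  proof (rule vacuum_generated)
    show "V.subspace ?W"
      using N' mod.M.subspace_0[OF N(2)] mod.M.subspace_add[OF N(2)] mod.M.subspace_scale[OF N(2)]
        V.subspace_0[OF V_subspace] V.subspace_add[OF V_subspace] V.subspace_scale[OF V_subspace]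
      by (intro V.subspaceI) (auto simp: mod.act_add_left mod.act_scal_left)
    show "vac V \<in> ?W"
      using N' vac_in mod.M.subspace_0[OF N(2)] by (simp add: mod.act_vac)
    fix a n u assume a: "a \<in> sl2" and u: "u \<in> ?W"
    have "act M (mode V (\<iota> a) n u) m w \<in> N" if w: "w \<in> N" for m w
      by (rule mod.iterate_in_subspace) (use a u w N N' closed \<iota>_in in auto)
    then show "mode V (\<iota> a) n u \<in> ?W" using a u mode_closed \<iota>_in by simp
  qed auto
  then show ?thesis using N unfolding submodule_def by blast
qed

text \<open>
  A weak form of the Poincare-Birkhoff-Witt theorem.  If the positive modes kill \<open>U\<close>, then the
  nonpositive modes alone generate the submodule of \<open>U\<close>: commuting a positive mode to the right past
  nonpositive ones produces only modes and scalars that are already under control.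
\<close>

lemma submodule_from_nonpositive_modes:
  assumes S: "mod.M.subspace S" "S \<subseteq> carr M" "U \<subseteq> S"
    and S_closed: "\<And>a n w. a \<in> sl2 \<Longrightarrow> n \<le> 0 \<Longrightarrow> w \<in> S \<Longrightarrow> act M (\<iota> a) n w \<in> S"
    and ann: "\<And>a n u. a \<in> sl2 \<Longrightarrow> n \<ge> 1 \<Longrightarrow> u \<in> U \<Longrightarrow> act M (\<iota> a) n u = 0"
  obtains Y where "submodule V M Y" "U \<subseteq> Y" "Y \<subseteq> S"
proof -
  define good where "good = (\<lambda>Z. mod.M.subspace Z \<and> Z \<subseteq> carr M \<and> U \<subseteq> Z \<and>
    (\<forall>a\<in>sl2. \<forall>n\<le>0. \<forall>w\<in>Z. act M (\<iota> a) n w \<in> Z))"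
  define Y where "Y = \<Inter>{Z. good Z}"
  have "good S" using S S_closed by (simp add: good_def)
  then have YS: "Y \<subseteq> S" by (auto simp: Y_def)
  have Ysub: "mod.M.subspace Y"
    unfolding Y_def by (rule mod.M.subspace_Inter) (simp add: good_def)
  have "U \<subseteq> Y" by (auto simp: Y_def good_def)
  have Yneg: "act M (\<iota> a) n w \<in> Y" if "a \<in> sl2" "n \<le> 0" "w \<in> Y" for a n w
    using that by (auto simp: Y_def good_def)
  have Yc: "w \<in> carr M" if "w \<in> Y" for w using that YS S by blast
  \<comment> \<open>Minimality of \<open>Y\<close> reduces closure under positive modes to goodness of this part of \<open>Y\<close>.\<close>
  let ?Y' = "{y \<in> Y. \<forall>a\<in>sl2. \<forall>m\<ge>1. act M (\<iota> a) m y \<in> Y}"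
  have "good ?Y'"
    unfolding good_def
  proof (intro conjI ballI allI impI)
    show "mod.M.subspace ?Y'"
      using Yc mod.M.subspace_0[OF Ysub] mod.M.subspace_add[OF Ysub] mod.M.subspace_scale[OF Ysub] \<iota>_in
      by (intro mod.M.subspaceI) (auto simp: mod.act_add_right mod.act_scal_right)
    show "?Y' \<subseteq> carr M" using Yc by blast
    show "U \<subseteq> ?Y'" using \<open>U \<subseteq> Y\<close> ann mod.M.subspace_0[OF Ysub] by auto
    fix b n y assume b: "b \<in> sl2" and n: "n \<le> (0::int)" and y: "y \<in> ?Y'"
    have "act M (\<iota> a) m (act M (\<iota> b) n y) \<in> Y" if a: "a \<in> sl2" and m: "m \<ge> 1" for a m
    proof -
      have "act M (\<iota> b) n (act M (\<iota> a) m y) \<in> Y" using Yneg a b m n y by blast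
      moreover have "act M (\<iota> (bracket a b)) (m + n) y \<in> Y"
        using Yneg[OF bracket_in_sl2] y bracket_in_sl2 by (cases "m + n \<ge> 1") auto
      ultimately show ?thesis
        using affine_commutator[OF a b Yc, of y m n] y Ysub
        by (auto simp: mod.M.subspace_add mod.M.subspace_scale)
    qed
    then show "act M (\<iota> b) n y \<in> ?Y'" using Yneg b n y by blast
  qed
  then have "Y \<subseteq> ?Y'" unfolding Y_def by blast
  have "submodule V M Y"
  proof (rule submodule_if_iota_closed)
    show "Y \<subseteq> carr M" using Yc by blast
    show "act M (\<iota> a) n w \<in> Y" if "a \<in> sl2" "w \<in> Y" for a n w
      using that Yneg \<open>Y \<subseteq> ?Y'\<close> by (cases "n \<ge> 1") auto
  qed (rule Ysub)
  then show ?thesis using that \<open>U \<subseteq> Y\<close> YS by blast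
qed

lemma iota_in_subspace:
  assumes a: "a \<in> sl2" and w: "w \<in> carr M" and D: "mod.M.subspace D"
    and "act M (\<iota> sl2_h) n w \<in> D" "act M (\<iota> sl2_e) n w \<in> D" "act M (\<iota> sl2_f) n w \<in> D"
  shows "act M (\<iota> a) n w \<in> D"
  by (subst sl2_basis_expansion[OF a])
    (use assms in \<open>simp add: \<iota>_add \<iota>_scal add_in_sl2 mscale_in_sl2 sl2_basis_in \<iota>_in mod.act_add_left
      mod.act_scal_left V.subspace_add[OF V_subspace] V.subspace_scale[OF V_subspace]
      mod.M.subspace_add mod.M.subspace_scale\<close>)

lemma iota_mscale_act:
  "a \<in> sl2 \<Longrightarrow> w \<in> carr M \<Longrightarrow> act M (\<iota> (mscale x a)) n w = scal M x (act M (\<iota> a) n w)"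
  by (simp add: \<iota>_scal \<iota>_in mod.act_scal_left)

lemma weight_in_coset:
  assumes full: "carr M = mod.M.span (\<Union>n::nat. weight_space V M (l + of_nat n))"
    and w: "w \<in> weight_space V M l'" "w \<noteq> 0"
  obtains n :: nat where "l' = l + of_nat n"
proof -
  have "w \<in> carr M" using w(1) by (simp add: weight_space_def)
  then have "w \<in> mod.M.span (\<Union>x\<in>range (\<lambda>n::nat. l + of_nat n). weight_space V M x)"
    unfolding full image_image .
  then have "l' \<in> range (\<lambda>n::nat. l + of_nat n)"
    using mod.weight_space_span_disjoint[OF conf_in w(1)] w(2) by metis
  then show ?thesis using that by blast
qed

end

section \<open>Low degrees of an irreducible highest weight module\<close>

lemma irreducible_submodule_eq_carr:
  "irreducible_module V M \<Longrightarrow> submodule V M N \<Longrightarrow> w \<in> N \<Longrightarrow> w \<noteq> 0 \<Longrightarrow> N = carr M"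
  unfolding irreducible_module_def by blast

text \<open>
  Nonpositive modes never lower the weight, so the weights of an irreducible module
  exceed that of any of its singular vectors by natural numbers.
\<close>

lemma (in affine_sl2_module) generated_by_singular_vector:
  assumes irr: "irreducible_module V M"
    and w: "w \<in> weight_space V M l" "w \<noteq> 0"
    and ann: "\<And>a n. a \<in> sl2 \<Longrightarrow> n \<ge> 1 \<Longrightarrow> act M (\<iota> a) n w = 0"
  shows "carr M = mod.M.span (\<Union>n::nat. weight_space V M (l + of_nat n))"
proof -
  let ?B = "\<Union>n::nat. weight_space V M (l + of_nat n)"
  let ?S = "mod.M.span ?B"
  have B: "?B \<subseteq> carr M" by (auto simp: weight_space_def)
  then have S: "?S \<subseteq> carr M" by (rule mod.M.span_minimal[OF _ mod.M_subspace])
  have wS: "{w} \<subseteq> ?S" using w by (auto intro!: mod.M.span_base exI[of _ 0])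
  obtain Y where Y: "submodule V M Y" "{w} \<subseteq> Y" "Y \<subseteq> ?S"
  proof (rule submodule_from_nonpositive_modes[OF mod.M.subspace_span S wS])
    fix a n x assume a: "a \<in> sl2" and n: "n \<le> (0::int)" and x: "x \<in> ?S"
    show "act M (\<iota> a) n x \<in> ?S"
    proof (rule mod.act_span[OF \<iota>_in[OF a] B mod.M.subspace_span _ x])
      fix y assume "y \<in> ?B"
      then obtain m :: nat where "y \<in> weight_space V M (l + of_nat m)" by blast
      then have "act M (\<iota> a) n y \<in> weight_space V M (l + of_nat m - of_int n)"
        by (rule iota_shifts_weight[OF a])
      moreover have "l + of_nat m - of_int n = l + of_nat (m + nat (- n))"
        using n by (simp add: of_nat_nat)
      ultimately have "act M (\<iota> a) n y \<in> ?B" by (metis UN_I UNIV_I)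
      then show "act M (\<iota> a) n y \<in> ?S" by (rule mod.M.span_base)
    qed
  next
    fix a u and n :: int assume "a \<in> sl2" "n \<ge> 1" "u \<in> {w}"
    then show "act M (\<iota> a) n u = 0" using ann by simp
  qed (rule that)
  have "Y = carr M"
    by (rule irreducible_submodule_eq_carr[OF irr Y(1) _ w(2)]) (use Y(2) in simp)
  then show ?thesis using Y(3) S by (intro equalityI) auto
qed

context affine_sl2_irreducible
begin

sublocale mod: voa_module V M
  using irreducible by (simp add: irreducible_module_def)

sublocale affine_sl2_module V k \<iota> M
  by unfold_locales

definition top_weight :: complex where
  "top_weight = of_nat i * (of_nat i + 2) / (4 * (of_nat k + 2))"

lemma v_in: "j \<le> i \<Longrightarrow> v j \<in> carr M"
  using v_span mod.M.span_base[of "v j" "v ` {..i}"] by (auto simp: weight_space_def)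

lemma v_nonzero: "j \<le> i \<Longrightarrow> v j \<noteq> 0"
  using v_independent(2) mod.M.dependent_zero[of "v ` {..i}"] by (metis atMost_iff imageI)

text \<open>
  On a vector killed by the positive modes, the Sugawara operator is the Casimir operator of the
  zero modes divided by \<open>2 (k + 2)\<close>.  It is evaluated at \<open>v i\<close>, the vector killed by \<open>f(0)\<close>.
\<close>

lemma conf_one_mode_v: "act M (conf V) 1 (v i) = scal M top_weight (v i)"
proof -
  have v: "v i \<in> carr M" by (simp add: v_in)
  have zero: "act M (\<iota> a) n (v i) = 0" if "a \<in> {sl2_h, sl2_e, sl2_f}" "n \<ge> 1" for a n
    using annihilation that by simp
  have X: "act M (mode V (\<iota> a) (-1) (\<iota> b)) 1 (v i) = act M (\<iota> b) 0 (act M (\<iota> a) 0 (v i))"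
    if ab: "a \<in> {sl2_h, sl2_e, sl2_f}" "b \<in> {sl2_h, sl2_e, sl2_f}" for a b
  proof -
    have "a \<in> sl2" "b \<in> sl2" using ab sl2_basis_in by auto
    then show ?thesis
      using mod.iterate_minus_one_mode_one[of "\<iota> a" "\<iota> b" "v i"] v zero[OF ab(1)] zero[OF ab(2)]
      by (simp add: \<iota>_in)
  qed
  have h: "act M (\<iota> sl2_h) 0 (act M (\<iota> sl2_h) 0 (v i)) = scal M (of_nat i * of_nat i) (v i)"
  proof -
    have "act M (\<iota> sl2_h) 0 (v i) = scal M (- of_nat i) (v i)" using h0[of i] by simp
    then show ?thesis
      using mod.act_scal_right[OF \<iota>_in[OF sl2_basis_in(1)] v, of 0 "- of_nat i"] by simp
  qed
  have ef: "act M (\<iota> sl2_f) 0 (act M (\<iota> sl2_e) 0 (v i)) = scal M (of_nat i) (v i)"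
  proof (cases i)
    case 0
    then show ?thesis using e0_top by (simp add: \<iota>_in sl2_basis_in)
  next
    case (Suc j)
    then have "act M (\<iota> sl2_e) 0 (v i) = v j" using e0[of i] by simp
    then show ?thesis using f0[of j] Suc by simp
  qed
  have fe: "act M (\<iota> sl2_e) 0 (act M (\<iota> sl2_f) 0 (v i)) = 0"
    using f0_bot by (simp add: \<iota>_in sl2_basis_in)
  have *: "act M (scal V s (scal V t x + y + z)) 1 (v i)
      = scal M s (scal M t (act M x 1 (v i)) + act M y 1 (v i) + act M z 1 (v i))"
    if "x \<in> carr V" "y \<in> carr V" "z \<in> carr V" for s t x y z
    using that v V.subspace_add[OF V_subspace] V.subspace_scale[OF V_subspace]
    by (simp add: mod.act_add_left mod.act_scal_left)
  have "act M (conf V) 1 (v i) = scal M (1 / (2 * (of_nat k + 2)))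
      (scal M (1/2) (scal M (of_nat i * of_nat i) (v i)) + scal M (of_nat i) (v i) + 0)"
    unfolding sugawara
    by (subst *) (simp_all add: X h ef fe sl2_basis_in mode_closed \<iota>_in)
  also have "\<dots> = scal M (1 / (2 * (of_nat k + 2)) * (1/2 * (of_nat i * of_nat i) + of_nat i)) (v i)"
    by (simp add: mod.M.scale_left_distrib mod.M.scale_right_distrib distrib_left)
  also have "1 / (2 * (of_nat k + 2)) * (1/2 * (of_nat i * of_nat i) + of_nat i) = top_weight"
    by (simp add: top_weight_def field_simps)
  finally show ?thesis .
qed

lemma
  shows is_lowest_top_weight: "is_lowest_weight V M top_weight"
    and top_weight_space_span: "weight_space V M top_weight = mod.M.span (v ` {..i})"
proof -
  obtain l where l: "is_lowest_weight V M l" "weight_space V M l = mod.M.span (v ` {..i})"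
    using v_span by blast
  have "v i \<in> weight_space V M l" unfolding l(2) by (simp add: mod.M.span_base)
  then have "scal M l (v i) = scal M top_weight (v i)"
    using conf_one_mode_v by (auto simp: weight_space_def)
  then have "l = top_weight" using v_nonzero[of i] by simp
  then show "is_lowest_weight V M top_weight"
    "weight_space V M top_weight = mod.M.span (v ` {..i})" using l by simp_all
qed

lemma v_in_top: "j \<le> i \<Longrightarrow> v j \<in> weight_space V M top_weight"
  unfolding top_weight_space_span by (simp add: mod.M.span_base)

lemma iota_annihilates_top:
  assumes "a \<in> sl2" "n \<ge> 1" "u \<in> weight_space V M top_weight"
  shows "act M (\<iota> a) n u = 0"
proof -
  have "\<not> top_weight \<le> top_weight - of_int n"
    using assms(2) by (simp add: less_eq_complex_def)
  then have "weight_space V M (top_weight - of_int n) = {0}"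
    using is_lowest_top_weight unfolding is_lowest_weight_def by blast
  then show ?thesis using iota_shifts_weight[OF assms(1,3), of n] by simp
qed

lemma span_weight_spaces_above_top:
  "carr M = mod.M.span (\<Union>n::nat. weight_space V M (top_weight + of_nat n))"
proof (rule generated_by_singular_vector[OF irreducible v_in_top v_nonzero])
  show "act M (\<iota> a) n (v i) = 0" if "a \<in> sl2" "n \<ge> 1" for a n
    by (rule iota_annihilates_top[OF that v_in_top]) simp
qed simp_all

text \<open>
  A nonzero singular vector would generate \<open>M\<close>, so the top weight and its own weight would each exceed
  the other by a natural number and hence agree.
\<close>

lemma no_singular_vectors:
  assumes w: "w \<in> weight_space V M l" and l: "l \<noteq> top_weight"
    and ann: "\<And>a n. a \<in> sl2 \<Longrightarrow> n \<ge> 1 \<Longrightarrow> act M (\<iota> a) n w = 0"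
  shows "w = 0"
proof (rule ccontr)
  assume w0: "w \<noteq> 0"
  have 1: "carr M = mod.M.span (\<Union>n::nat. weight_space V M (l + of_nat n))"
    using generated_by_singular_vector[OF irreducible w w0] ann by blast
  obtain n :: nat where n: "l = top_weight + of_nat n"
    by (rule weight_in_coset[OF span_weight_spaces_above_top w w0])
  obtain m :: nat where m: "top_weight = l + of_nat m"
    by (rule weight_in_coset[OF 1 v_in_top v_nonzero]) (rule le_refl, rule le_refl)
  have "(of_nat (n + m) :: complex) = 0" using n m by (simp add: add.commute)
  then show False using n l by (simp only: of_nat_eq_0_iff) simp
qed

text \<open>
  The span of the top level, the vectors \<open>a(-1) u\<close> and all weight spaces of degree at least two is
  stable under nonpositive modes; the only case in which degree one maps to degree one is
  \<open>a(0) b(-1) u = b(-1) a(0) u + [a,b](-1) u\<close>.  Hence this span is \<open>M\<close>, and comparing weights leaves the vectors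
  \<open>a(-1) u\<close> in degree one.
\<close>

lemma first_degree_spanned:
  "weight_space V M (top_weight + 1)
    \<subseteq> mod.M.span {act M (\<iota> a) (-1) u | a u. a \<in> sl2 \<and> u \<in> weight_space V M top_weight}"
    (is "_ \<subseteq> mod.M.span ?A")
proof -
  let ?T = "weight_space V M top_weight"
  define L where "L = insert top_weight ((\<lambda>n::nat. top_weight + of_nat n) ` {2..})"
  let ?R = "\<Union>l\<in>L. weight_space V M l"
  let ?S = "mod.M.span (?A \<union> ?R)"
  have A1: "?A \<subseteq> weight_space V M (top_weight + 1)"
    using iota_shifts_weight[of _ _ top_weight "-1"] by auto
  have B: "?A \<union> ?R \<subseteq> carr M" using A1 by (auto simp: weight_space_def)
  then have S: "?S \<subseteq> carr M" by (rule mod.M.span_minimal[OF _ mod.M_subspace])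
  have TS: "?T \<subseteq> ?S" using mod.M.span_superset by (fastforce simp: L_def)
  have high: "x \<in> ?S" if "x \<in> weight_space V M (top_weight + of_nat n)" "n \<ge> 2" for x n
    using that by (intro mod.M.span_base) (auto simp: L_def)
  have shift: "act M (\<iota> a) n x \<in> ?S"
    if "a \<in> sl2" "x \<in> weight_space V M (top_weight + of_nat m)" "int m - n \<ge> 2" for a n m x
  proof (rule high)
    have "top_weight + of_nat m - of_int n = top_weight + of_int (int m - n)" by simp
    also have "\<dots> = top_weight + of_nat (nat (int m - n))" using that(3) by (simp add: of_nat_nat)
    finally show "act M (\<iota> a) n x \<in> weight_space V M (top_weight + of_nat (nat (int m - n)))"
      using iota_shifts_weight[OF that(1,2), of n] by (simp only:)
  qed (use that(3) in simp)
  obtain Y where Y: "submodule V M Y" "?T \<subseteq> Y" "Y \<subseteq> ?S"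
  proof (rule submodule_from_nonpositive_modes[OF mod.M.subspace_span S TS])
    fix a n x assume a: "a \<in> sl2" and n: "n \<le> (0::int)" and x: "x \<in> ?S"
    have top: "act M (\<iota> a) n y \<in> ?S" if y: "y \<in> ?T" for y
    proof -
      consider "n = 0" | "n = -1" | "n \<le> -2" using n by linarith
      then show ?thesis
      proof cases
        case 1
        then show ?thesis using iota_shifts_weight[OF a y, of 0] TS by auto
      next
        case 2
        then show ?thesis using a y by (intro mod.M.span_base) blast
      next
        case 3
        then show ?thesis using shift[OF a, of y 0] y by simp
      qed
    qed
    show "act M (\<iota> a) n x \<in> ?S"
    proof (rule mod.act_span[OF \<iota>_in[OF a] B mod.M.subspace_span _ x])
      fix y assume "y \<in> ?A \<union> ?R"
      then consider (one) b u where "b \<in> sl2" "u \<in> ?T" "y = act M (\<iota> b) (-1) u"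
        | (zero) "y \<in> ?T"
        | (two) m :: nat where "m \<ge> 2" "y \<in> weight_space V M (top_weight + of_nat m)"
        unfolding L_def by blast
      then show "act M (\<iota> a) n y \<in> ?S"
      proof cases
        case one
        show ?thesis
        proof (cases "n = 0")
          case True
          have u: "u \<in> carr M" using one(2) by (simp add: weight_space_def)
          have "act M (\<iota> a) 0 u \<in> ?T" using iota_shifts_weight[OF a one(2), of 0] by simp
          then have "act M (\<iota> b) (-1) (act M (\<iota> a) 0 u) \<in> ?S"
            "act M (\<iota> (bracket a b)) (-1) u \<in> ?S"
            using one bracket_in_sl2[of a b] by (blast intro: mod.M.span_base)+
          then show ?thesis
            using affine_commutator[OF a one(1) u, of 0 "-1"] True one(3)
            by (simp add: mod.M.span_add)
        next
          case False
          then have "n \<le> -1" using n by linarith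
          moreover have "y \<in> weight_space V M (top_weight + of_nat 1)" using one A1 by auto
          ultimately show ?thesis using shift[OF a, of y 1] by simp
        qed
      next
        case zero
        then show ?thesis by (rule top)
      next
        case two
        then show ?thesis using shift[OF a two(2)] n by simp
      qed
    qed
  next
    show "act M (\<iota> a) n u = 0" if "a \<in> sl2" "n \<ge> 1" "u \<in> ?T" for a n u
      using iota_annihilates_top that .
  qed (rule that)
  have "Y = carr M"
    by (rule irreducible_submodule_eq_carr[OF irreducible Y(1) _ v_nonzero[of i]])
      (use Y(2) v_in_top[of i] in auto)
  then have full: "carr M \<subseteq> ?S" using Y(3) by simp
  show ?thesis
  proof
    fix w assume w: "w \<in> weight_space V M (top_weight + 1)"
    then have "w \<in> ?S" using full by (auto simp: weight_space_def)
    then obtain y z where yz: "y \<in> mod.M.span ?A" "z \<in> mod.M.span ?R" "w = y + z"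
      unfolding mod.M.span_Un by blast
    have sub: "mod.M.subspace (weight_space V M (top_weight + 1))"
      using mod.mod_grading by (simp add: internal_direct_sum_def)
    have "y \<in> weight_space V M (top_weight + 1)"
      using mod.M.span_minimal[OF A1 sub] yz(1) by blast
    then have z1: "z \<in> weight_space V M (top_weight + 1)"
      using mod.M.subspace_diff[OF sub w] yz(3) by fastforce
    have "top_weight + 1 \<notin> L"
    proof
      assume "top_weight + 1 \<in> L"
      then obtain n :: nat where "top_weight + 1 = top_weight + of_nat n" "n \<noteq> 1"
        by (auto simp: L_def)
      then show False by (metis add_left_cancel of_nat_eq_1_iff)
    qed
    then have "z = 0"
      using mod.weight_space_span_disjoint[OF conf_in z1 yz(2)] by simp
    then show "w \<in> mod.M.span ?A" using yz by simp
  qed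
qed

end

section \<open>The grading by \<open>h(0)\<close>\<close>

context affine_sl2_irreducible
begin

text \<open>
  Parametrising the eigenvalue as \<open>2 t - i\<close> puts \<open>v i, v (i - 1), v (i - 2)\<close> at \<open>t = 0, 1, 2\<close> and makes
  \<open>e\<close> and \<open>f\<close> change \<open>t\<close> by one.
\<close>

definition h_space :: "int \<Rightarrow> 'm set" where
  "h_space t = {w \<in> carr M. act M (\<iota> sl2_h) 0 w = scal M (of_int (2 * t - int i)) w}"

definition h_class :: "int \<Rightarrow> 'm set" where
  "h_class s = mod.M.span (\<Union>t\<in>{t. t mod 3 = s mod 3}. h_space t)"

lemma h_class_mod: "s mod 3 = t mod 3 \<Longrightarrow> h_class s = h_class t"
  by (simp add: h_class_def)

lemma h_space_in_class: "w \<in> h_space t \<Longrightarrow> t mod 3 = s mod 3 \<Longrightarrow> w \<in> h_class s"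
  unfolding h_class_def by (intro mod.M.span_base) blast

lemma h_class_subspace: "mod.M.subspace (h_class s)"
  by (simp add: h_class_def)

lemma h_class_carr: "h_class s \<subseteq> carr M"
  unfolding h_class_def
  by (rule mod.M.span_minimal[OF _ mod.M_subspace]) (auto simp: h_space_def)

lemma v_in_h_space: "j \<le> i \<Longrightarrow> v j \<in> h_space (int (i - j))"
  using h0[of j] v_in[of j] by (simp add: h_space_def of_nat_diff)

lemma iota_shifts_h_space:
  assumes a: "a \<in> sl2" and br: "bracket sl2_h a = mscale (of_int (2 * d)) a"
    and w: "w \<in> h_space t"
  shows "act M (\<iota> a) n w \<in> h_space (t + d)"
proof -
  have wc: "w \<in> carr M" using w by (simp add: h_space_def)
  have "act M (\<iota> sl2_h) 0 (act M (\<iota> a) n w) = act M (\<iota> a) n (act M (\<iota> sl2_h) 0 w)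
      + scal M (of_int (2 * d)) (act M (\<iota> a) n w)"
    using affine_commutator[OF sl2_basis_in(1) a wc, of 0 n] a wc
    unfolding br by (simp add: \<iota>_scal \<iota>_in mod.act_scal_left)
  also have "act M (\<iota> a) n (act M (\<iota> sl2_h) 0 w)
      = scal M (of_int (2 * t - int i)) (act M (\<iota> a) n w)"
    using w a wc by (simp only: h_space_def mem_Collect_eq mod.act_scal_right \<iota>_in)
  also have "\<dots> + scal M (of_int (2 * d)) (act M (\<iota> a) n w)
      = scal M (of_int (2 * (t + d) - int i)) (act M (\<iota> a) n w)"
  proof -
    have "2 * (t + d) - int i = (2 * t - int i) + 2 * d" by simp
    then show ?thesis by (simp only: of_int_add mod.M.scale_left_distrib)
  qed
  finally show ?thesis
    using a wc by (simp add: h_space_def mod.act_closed \<iota>_in)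
qed

lemma iota_shifts_h_class:
  assumes a: "a \<in> sl2" and br: "bracket sl2_h a = mscale (of_int (2 * d)) a"
    and w: "w \<in> h_class s"
  shows "act M (\<iota> a) n w \<in> h_class (s + d)"
proof (rule mod.act_span[OF \<iota>_in[OF a] _ h_class_subspace _ w[unfolded h_class_def]])
  show "(\<Union>t\<in>{t. t mod 3 = s mod 3}. h_space t) \<subseteq> carr M" by (auto simp: h_space_def)
  fix x assume "x \<in> (\<Union>t\<in>{t. t mod 3 = s mod 3}. h_space t)"
  then obtain t where "t mod 3 = s mod 3" "x \<in> h_space t" by blast
  then show "act M (\<iota> a) n x \<in> h_class (s + d)"
    using h_space_in_class[OF iota_shifts_h_space[OF a br]] mod_add_cong by blast
qed

lemma sl2_h_degrees:
  "bracket sl2_h sl2_h = mscale (of_int (2 * 0)) sl2_h"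
  "bracket sl2_h sl2_e = mscale (of_int (2 * 1)) sl2_e"
  "bracket sl2_h sl2_f = mscale (of_int (2 * (-1))) sl2_f"
  using sl2_brackets by (simp_all add: bracket_def mscale_def vec_eq_iff)

lemmas h_shifts_h_class = iota_shifts_h_class[OF sl2_basis_in(1) sl2_h_degrees(1)]
lemmas e_shifts_h_class = iota_shifts_h_class[OF sl2_basis_in(2) sl2_h_degrees(2)]
lemmas f_shifts_h_class = iota_shifts_h_class[OF sl2_basis_in(3) sl2_h_degrees(3)]

text \<open>
  The modes of \<open>h\<close>, \<open>e\<close>, \<open>f\<close> map classes into classes, so the sum of the classes is a submodule.
\<close>

lemma h_classes_span: "mod.M.span (h_class 0 \<union> h_class 1 \<union> h_class 2) = carr M"
proof -
  let ?B = "h_class 0 \<union> h_class 1 \<union> h_class 2"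
  have B: "?B \<subseteq> carr M" using h_class_carr by blast
  have all: "h_class s \<subseteq> ?B" for s
  proof -
    have "s mod 3 = 0 \<or> s mod 3 = 1 \<or> s mod 3 = 2" by presburger
    then consider "s mod 3 = 0" | "s mod 3 = 1" | "s mod 3 = 2" by blast
    then show ?thesis
    proof cases
      case 1 then show ?thesis using h_class_mod[of s 0] by auto
    next
      case 2 then show ?thesis using h_class_mod[of s 1] by auto
    next
      case 3 then show ?thesis using h_class_mod[of s 2] by auto
    qed
  qed
  have "submodule V M (mod.M.span ?B)"
  proof (rule submodule_if_iota_closed)
    show "mod.M.span ?B \<subseteq> carr M" by (rule mod.M.span_minimal[OF B mod.M_subspace])
    fix a n w assume a: "a \<in> sl2" and w: "w \<in> mod.M.span ?B"
    show "act M (\<iota> a) n w \<in> mod.M.span ?B"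
    proof (rule mod.act_span[OF \<iota>_in[OF a] B mod.M.subspace_span _ w])
      fix x assume "x \<in> ?B"
      then obtain s where x: "x \<in> h_class s" by blast
      have "x \<in> carr M" using x h_class_carr by blast
      moreover have "y \<in> mod.M.span ?B" if "y \<in> h_class r" for y r
        by (rule mod.M.span_base, rule subsetD[OF all that])
      ultimately show "act M (\<iota> a) n x \<in> mod.M.span ?B"
        using h_shifts_h_class[OF x, of n] e_shifts_h_class[OF x, of n] f_shifts_h_class[OF x, of n]
        by (intro iota_in_subspace[OF a _ mod.M.subspace_span])
    qed
  qed simp
  moreover have "v 0 \<in> mod.M.span ?B"
    by (rule mod.M.span_base, rule subsetD[OF all])
      (rule h_space_in_class[OF v_in_h_space[of 0] refl], simp)
  ultimately show ?thesis
    by (rule irreducible_submodule_eq_carr[OF irreducible _ _ v_nonzero]) simp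
qed

lemma h_class_independent:
  assumes "w \<in> h_class s" "w \<in> mod.M.span (\<Union>r\<in>R. h_class r)" "\<And>r. r \<in> R \<Longrightarrow> r mod 3 \<noteq> s mod 3"
  shows "w = 0"
proof -
  let ?A = "{t. t mod 3 = s mod 3}" and ?B = "{t. t mod 3 \<noteq> s mod 3}"
  have "h_class r \<subseteq> mod.M.span (\<Union>t\<in>?B. h_space t)" if "r \<in> R" for r
    unfolding h_class_def
    by (rule mod.M.span_mono, rule UN_mono) (use assms(3)[OF that] in auto)
  then have "(\<Union>r\<in>R. h_class r) \<subseteq> mod.M.span (\<Union>t\<in>?B. h_space t)" by blast
  then have B: "w \<in> mod.M.span (\<Union>t\<in>?B. h_space t)"
    using mod.M.span_minimal[OF _ mod.M.subspace_span] assms(2) by blast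
  show ?thesis
  proof (rule mod.M.span_eigenspaces_disjoint[OF mod.M_subspace,
        of "act M (\<iota> sl2_h) 0" ?A ?B "\<lambda>t. of_int (2 * t - int i)"])
    show "inj_on (\<lambda>t. of_int (2 * t - int i) :: complex) (?A \<union> ?B)"
      by (auto simp: inj_on_def)
  qed (use B assms(1) in \<open>auto simp: mod.act_add_right mod.act_scal_right \<iota>_in sl2_basis_in
      h_class_def h_space_def\<close>)
qed

lemma h_classes_direct_sum:
  "internal_direct_sum (scal M) (carr M) {..<3::nat} (nth [h_class 0, h_class 1, h_class 2])"
proof -
  have I: "{..<3::nat} = {0, 1, 2}" by auto
  have nth: "[h_class 0, h_class 1, h_class 2] ! j = h_class (int j)" if "j \<in> {..<3}" for j
    using that unfolding I by auto
  have "h_class (int j) \<inter> mod.M.span (\<Union>r\<in>int ` ({..<3} - {j}). h_class r) = {0}"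
    if j: "j \<in> {..<3}" for j
  proof -
    have "r mod 3 \<noteq> int j mod 3" if "r \<in> int ` ({..<3} - {j})" for r
      using that j by auto
    then show ?thesis
      using h_class_independent[of _ "int j"] mod.M.subspace_0[OF h_class_subspace] mod.M.span_zero
      by blast
  qed
  moreover have "(\<Union>r\<in>{..<3} - {j}. [h_class 0, h_class 1, h_class 2] ! r)
      = (\<Union>r\<in>int ` ({..<3} - {j}). h_class r)" for j
    using nth by auto
  moreover have "(\<Union>r\<in>{..<3}. [h_class 0, h_class 1, h_class 2] ! r)
      = h_class 0 \<union> h_class 1 \<union> h_class 2"
    unfolding I by auto
  ultimately show ?thesis
    unfolding internal_direct_sum_def using nth h_class_subspace h_classes_span by simp
qed

end

section \<open>The fixed-point algebra and its action on the classes\<close>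

locale z3_orbifold = affine_sl2_irreducible V k \<iota> i M v
  for V :: "('v::ab_group_add) voa" and k :: nat and \<iota> :: "mat2 \<Rightarrow> 'v"
    and i :: nat and M :: "('v, 'm::ab_group_add) voa_mod" and v :: "nat \<Rightarrow> 'm" +
  fixes \<sigma> :: "'v \<Rightarrow> 'v"
  assumes automorphism: "voa_automorphism V \<sigma>"
    and \<sigma>_iota: "a \<in> sl2 \<Longrightarrow> \<sigma> (\<iota> a) = \<iota> (sl2_sigma a)"
begin

definition \<omega> :: complex where "\<omega> = (-1 + \<i> * sqrt 3) / 2"

lemma \<omega>_square: "\<omega>\<^sup>2 = (-1 - \<i> * sqrt 3) / 2"
  by (simp add: \<omega>_def power2_eq_square complex_eq_iff field_simps)

lemma \<omega>_cube: "\<omega> ^ 3 = 1"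
proof -
  have "\<omega> ^ 3 = \<omega> * \<omega>\<^sup>2" by (simp add: power3_eq_cube power2_eq_square)
  also have "\<dots> = 1" unfolding \<omega>_square by (simp add: \<omega>_def complex_eq_iff field_simps)
  finally show ?thesis .
qed

lemma \<omega>_powers_distinct: "inj_on (\<lambda>r. \<omega> ^ r) {0, 1, 2}"
  by (simp add: \<omega>_square) (simp add: \<omega>_def complex_eq_iff)

lemma \<sigma>_hom:
  "a \<in> carr V \<Longrightarrow> \<sigma> a \<in> carr V"
  "a \<in> carr V \<Longrightarrow> b \<in> carr V \<Longrightarrow> \<sigma> (a + b) = \<sigma> a + \<sigma> b"
  "a \<in> carr V \<Longrightarrow> \<sigma> (scal V x a) = scal V x (\<sigma> a)"
  "a \<in> carr V \<Longrightarrow> b \<in> carr V \<Longrightarrow> \<sigma> (mode V a n b) = mode V (\<sigma> a) n (\<sigma> b)"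
  "\<sigma> (vac V) = vac V" "\<sigma> (conf V) = conf V"
  using automorphism bij_betwE by (auto simp: voa_automorphism_def)

text \<open>
  Elements homogeneous for \<open>\<sigma>\<close> and, compatibly, for the grading of \<open>M\<close> by classes.  Both conditions are
  imposed together so that the span of the components can be found by generation from the vacuum;
  the index matters only modulo \<open>3\<close>.
\<close>

definition \<sigma>_component :: "nat \<Rightarrow> 'v set" where
  "\<sigma>_component r = {u \<in> carr V. \<sigma> u = scal V (\<omega> ^ r) u \<and>
     (\<forall>s n. \<forall>w\<in>h_class s. act M u n w \<in> h_class (s + int r))}"

lemma \<sigma>_component_add_3: "\<sigma>_component (r + 3) = \<sigma>_component r"
proof -
  have "h_class (s + int (r + 3)) = h_class (s + int r)" for s
    by (rule h_class_mod) presburger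
  then show ?thesis by (simp add: \<sigma>_component_def power_add \<omega>_cube)
qed

lemma \<sigma>_component_subspace: "V.subspace (\<sigma>_component r)"
proof (rule V.subspaceI)
  have c: "w \<in> carr M" if "w \<in> h_class s" for w s using that h_class_carr by blast
  have "\<sigma> 0 = 0" using \<sigma>_hom(3)[OF vac_in, of 0] by simp
  then show "0 \<in> \<sigma>_component r"
    using V.subspace_0[OF V_subspace] mod.M.subspace_0[OF h_class_subspace] c
    by (simp add: \<sigma>_component_def)
  show "x + y \<in> \<sigma>_component r" if "x \<in> \<sigma>_component r" "y \<in> \<sigma>_component r" for x y
    using that V.subspace_add[OF V_subspace] mod.M.subspace_add[OF h_class_subspace] c
    by (simp add: \<sigma>_component_def \<sigma>_hom mod.act_add_left V.scale_right_distrib)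
  show "scal V b x \<in> \<sigma>_component r" if "x \<in> \<sigma>_component r" for b x
    using that V.subspace_scale[OF V_subspace] mod.M.subspace_scale[OF h_class_subspace] c
    by (simp add: \<sigma>_component_def \<sigma>_hom mod.act_scal_left mult.commute)
qed

text \<open>
  The degrees add: for \<open>\<sigma>\<close> because it is an automorphism, for the action on classes by
  the iterate formula.
\<close>

lemma mode_\<sigma>_component:
  assumes a: "a \<in> \<sigma>_component d" and b: "b \<in> \<sigma>_component r"
  shows "mode V a n b \<in> \<sigma>_component (d + r)"
proof -
  have ac: "a \<in> carr V" and bc: "b \<in> carr V" using a b by (auto simp: \<sigma>_component_def)
  have "act M (mode V a n b) m w \<in> h_class (s + int (d + r))" if w: "w \<in> h_class s" for s m w
  proof (rule mod.iterate_in_subspace[OF ac bc _ h_class_subspace])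
    show "w \<in> carr M" using w h_class_carr by blast
    have A: "act M a p x \<in> h_class (s' + int d)" if "x \<in> h_class s'" for p x s'
      using a that by (simp add: \<sigma>_component_def)
    have B: "act M b p x \<in> h_class (s' + int r)" if "x \<in> h_class s'" for p x s'
      using b that by (simp add: \<sigma>_component_def)
    show "act M a p (act M b q w) \<in> h_class (s + int (d + r))" for p q
      using A[OF B[OF w]] by (simp add: algebra_simps)
    show "act M b p (act M a q w) \<in> h_class (s + int (d + r))" for p q
      using B[OF A[OF w]] by (simp add: algebra_simps)
  qed
  moreover have "\<sigma> (mode V a n b) = scal V (\<omega> ^ (d + r)) (mode V a n b)"
  proof -
    have "\<sigma> (mode V a n b) = mode V (scal V (\<omega> ^ d) a) n (scal V (\<omega> ^ r) b)"
      using a b ac bc \<sigma>_hom(4) by (simp add: \<sigma>_component_def)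
    also have "\<dots> = scal V (\<omega> ^ d) (scal V (\<omega> ^ r) (mode V a n b))"
      using ac bc V.subspace_scale[OF V_subspace bc]
        act_scal_left[of a "scal V (\<omega> ^ r) b" "\<omega> ^ d" n] act_scal_right[of a b n "\<omega> ^ r"]
      by (simp add: adjoint_module_def)
    finally show ?thesis by (simp add: power_add)
  qed
  ultimately show ?thesis
    using mode_closed[OF ac bc] unfolding \<sigma>_component_def by blast
qed

lemma basis_\<sigma>_components:
  "\<iota> sl2_h \<in> \<sigma>_component 0" "\<iota> sl2_e \<in> \<sigma>_component 1" "\<iota> sl2_f \<in> \<sigma>_component 2"
proof -
  show "\<iota> sl2_h \<in> \<sigma>_component 0"
    using h_shifts_h_class
    by (simp add: \<sigma>_component_def \<iota>_in sl2_basis_in \<sigma>_iota sl2_sigma_basis)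
  show "\<iota> sl2_e \<in> \<sigma>_component 1"
    using e_shifts_h_class
    by (simp add: \<sigma>_component_def \<iota>_in sl2_basis_in \<sigma>_iota sl2_sigma_basis \<iota>_scal \<omega>_def)
  have "h_class (s + -1) = h_class (s + int 2)" for s
    by (rule h_class_mod) presburger
  then have "act M (\<iota> sl2_f) n w \<in> h_class (s + int 2)" if "w \<in> h_class s" for n w s
    using f_shifts_h_class[OF that] by simp
  then show "\<iota> sl2_f \<in> \<sigma>_component 2"
    unfolding \<sigma>_component_def \<omega>_square
    by (simp add: \<iota>_in sl2_basis_in \<sigma>_iota sl2_sigma_basis \<iota>_scal)
qed

lemma vac_\<sigma>_component: "vac V \<in> \<sigma>_component 0"
proof -
  have "act M (vac V) n w \<in> h_class s" if w: "w \<in> h_class s" for s n w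
  proof -
    have "w \<in> carr M" using w h_class_carr by blast
    then show ?thesis using w mod.M.subspace_0[OF h_class_subspace] by (simp add: mod.act_vac)
  qed
  then show ?thesis by (simp add: \<sigma>_component_def vac_in \<sigma>_hom)
qed

lemma \<sigma>_components_span: "V.span (\<Union>r\<in>{0, 1, 2}. \<sigma>_component r) = carr V"
proof (rule vacuum_generated)
  let ?B = "\<Union>r\<in>{0, 1, 2}. \<sigma>_component r"
  have B: "?B \<subseteq> carr V" by (auto simp: \<sigma>_component_def)
  show W: "V.span ?B \<subseteq> carr V" by (rule V.span_minimal[OF B V_subspace])
  show "vac V \<in> V.span ?B" using vac_\<sigma>_component by (intro V.span_base) blast
  have all: "\<sigma>_component r \<subseteq> ?B" if "r \<le> 4" for r
  proof -
    have "r \<in> {0, 1, 2} \<or> r = 0 + 3 \<or> r = 1 + 3" using that by auto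
    then show ?thesis using \<sigma>_component_add_3 by blast
  qed
  fix a n u assume a: "a \<in> sl2" and u: "u \<in> V.span ?B"
  have basis: "mode V (\<iota> b) n x \<in> V.span ?B"
    if b: "\<iota> b \<in> \<sigma>_component d" "d \<le> 2" and x: "x \<in> ?B" for b d x
  proof -
    obtain r where r: "r \<in> {0, 1, 2}" "x \<in> \<sigma>_component r" using x by blast
    then have "mode V (\<iota> b) n x \<in> \<sigma>_component (d + r)" using mode_\<sigma>_component b by blast
    then show ?thesis using all[of "d + r"] b(2) r(1) by (intro V.span_base) auto
  qed
  have "mode V (\<iota> a) n x \<in> V.span ?B" if x: "x \<in> ?B" for x
  proof -
    have "x \<in> carr V" using x B by blast
    then have "mode V (\<iota> a) n x = scal V (a $ 1 $ 1) (mode V (\<iota> sl2_h) n x)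
        + scal V (a $ 1 $ 2) (mode V (\<iota> sl2_e) n x) + scal V (a $ 2 $ 1) (mode V (\<iota> sl2_f) n x)"
      using act_add_left[of _ _ x n] act_scal_left[of _ x _ n]
        V.subspace_add[OF V_subspace] V.subspace_scale[OF V_subspace]
      by (subst sl2_basis_expansion[OF a])
        (simp add: \<iota>_add \<iota>_scal add_in_sl2 mscale_in_sl2 sl2_basis_in \<iota>_in adjoint_module_def)
    then show ?thesis
      using basis[OF basis_\<sigma>_components(1) _ x] basis[OF basis_\<sigma>_components(2) _ x]
        basis[OF basis_\<sigma>_components(3) _ x]
      by (simp add: V.span_add V.span_scale)
  qed
  then show "mode V (\<iota> a) n u \<in> V.span ?B"
    using act_span[of "\<iota> a" ?B "V.span ?B" n u] B u \<iota>_in[OF a]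
    by (simp add: adjoint_module_def)
qed simp

text \<open>
  Decompose a fixed vector \<open>u\<close> into components.  Moving \<open>u\<close> into the zeroth one gives a vanishing
  sum of eigenvectors of \<open>\<sigma>\<close> with distinct eigenvalues, so \<open>u\<close> is its own zeroth component.
\<close>

lemma fixed_points_eq_\<sigma>_component: "{a \<in> carr V. \<sigma> a = a} = \<sigma>_component 0"
proof
  show "\<sigma>_component 0 \<subseteq> {a \<in> carr V. \<sigma> a = a}" by (auto simp: \<sigma>_component_def)
  show "{a \<in> carr V. \<sigma> a = a} \<subseteq> \<sigma>_component 0"
  proof
    fix u assume "u \<in> {a \<in> carr V. \<sigma> a = a}"
    then have u: "u \<in> carr V" "\<sigma> u = u" by auto
    have \<sigma>0: "\<sigma> 0 = 0" using \<sigma>_hom(3)[OF vac_in, of 0] by simp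
    obtain S x where S: "finite S" "S \<subseteq> {0, 1, 2}" "\<And>r. r \<in> S \<Longrightarrow> x r \<in> \<sigma>_component r" "u = sum x S"
    proof (rule V.span_UN_subspaces_sum[OF \<sigma>_component_subspace])
      show "u \<in> V.span (\<Union>r\<in>{0, 1, 2}. \<sigma>_component r)" using u(1) \<sigma>_components_span by simp
    qed (rule that)
    \<comment> \<open>The family of components of \<open>u\<close>, extended by zero outside \<open>S\<close>, with \<open>u\<close> subtracted in degree zero.\<close>
    define y where "y = (\<lambda>r. (if r \<in> S then x r else 0) - (if r = 0 then u else 0))"
    have comp: "\<sigma>_component r \<subseteq> {w \<in> carr V. \<sigma> w = scal V (\<omega> ^ r) w}" for r
      by (auto simp: \<sigma>_component_def)
    have eig: "y r \<in> carr V \<and> \<sigma> (y r) = scal V (\<omega> ^ r) (y r)" for r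
    proof -
      let ?c = "if r \<in> S then x r else 0" and ?d = "if r = 0 then u else 0"
      have c: "?c \<in> carr V" "\<sigma> ?c = scal V (\<omega> ^ r) ?c"
        using S(3) comp \<sigma>0 V.subspace_0[OF V_subspace] by auto
      have d: "?d \<in> carr V" "\<sigma> ?d = scal V (\<omega> ^ r) ?d"
        using u \<sigma>0 V.subspace_0[OF V_subspace] by auto
      have "\<sigma> ?c = \<sigma> (?c - ?d) + \<sigma> ?d"
        using \<sigma>_hom(2)[OF V.subspace_diff[OF V_subspace c(1) d(1)] d(1)] by simp
      then show ?thesis
        using c d V.subspace_diff[OF V_subspace c(1) d(1)]
        unfolding y_def by (simp only: V.scale_right_diff_distrib) (metis add_diff_cancel_right')
    qed
    have "sum y {0, 1, 2} = (\<Sum>r\<in>{0, 1, 2}. if r \<in> S then x r else 0) - u"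
      unfolding y_def by (simp add: sum_subtractf)
    also have "(\<Sum>r\<in>{0, 1, 2}. if r \<in> S then x r else 0) = sum x S"
      using S(2) by (subst sum.inter_restrict[symmetric]) (auto simp: Int_absorb1)
    finally have sum: "sum y {0, 1, 2} \<in> {0}" using S(4) by simp
    have "\<forall>r\<in>{0, 1, 2}. y r \<in> {0}"
      by (rule V.eigenvector_components_in_stable_subspace[OF V_subspace \<sigma>_hom(2) \<sigma>_hom(3)
            V.subspace_single_0 _ _ \<omega>_powers_distinct eig sum])
        (use \<sigma>0 in auto)
    then have "u = (if 0 \<in> S then x 0 else 0)" by (simp add: y_def)
    then show "u \<in> \<sigma>_component 0"
      using S(3) V.subspace_0[OF \<sigma>_component_subspace] by (cases "0 \<in> S") simp_all
  qed
qed

lemma fixed_point_voa_eq: "fixed_point_voa V {id, \<sigma>, \<sigma> \<circ> \<sigma>} = V\<lparr>carr := \<sigma>_component 0\<rparr>"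
proof -
  have "{a \<in> carr V. \<forall>g\<in>{id, \<sigma>, \<sigma> \<circ> \<sigma>}. g a = a} = {a \<in> carr V. \<sigma> a = a}" by auto
  then show ?thesis unfolding fixed_point_voa_def fixed_points_eq_\<sigma>_component by simp
qed

text \<open>
  The key step of the irreducibility proof: \<open>M\<close> is spanned by the \<open>u\<^sub>n x\<close> with \<open>x\<close> in \<open>N\<close>, and only
  homogeneous \<open>u\<close> of degree zero can contribute to the class that contains \<open>N\<close>.
\<close>

lemma fixed_point_submodule_of_h_class:
  assumes N: "mod.M.subspace N" "N \<subseteq> h_class s" "w \<in> N" "w \<noteq> 0"
    and closed: "\<And>a n w. a \<in> \<sigma>_component 0 \<Longrightarrow> w \<in> N \<Longrightarrow> act M a n w \<in> N"
  shows "N = h_class s"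
proof
  let ?R = "\<Union>r\<in>{s + 1, s + 2}. h_class r"
  have Nc: "N \<subseteq> carr M" using N(2) h_class_carr by blast
  let ?B = "{act M u n x | u n x. u \<in> carr V \<and> x \<in> N}"
  have "w = act M (vac V) (-1) w" using N(3) Nc by (simp add: mod.act_vac subset_iff)
  then have "w \<in> ?B" using N(3) vac_in by blast
  then have "w \<in> mod.M.span ?B" by (rule mod.M.span_base)
  then have B: "mod.M.span ?B = carr M"
    by (rule irreducible_submodule_eq_carr[OF irreducible mod.span_of_actions_submodule[OF Nc] _ N(4)])
  have "?B \<subseteq> mod.M.span (N \<union> ?R)"
  proof
    fix z assume "z \<in> ?B"
    then obtain u n x where u: "u \<in> carr V" and x: "x \<in> N" and z: "z = act M u n x" by blast
    have xc: "x \<in> carr M" using x Nc by blast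
    have xs: "x \<in> h_class s" using x N(2) by blast
    show "z \<in> mod.M.span (N \<union> ?R)"
      unfolding z
    proof (rule mod.act_span_left[OF xc _ mod.M.subspace_span])
      show "u \<in> V.span (\<Union>r\<in>{0, 1, 2}. \<sigma>_component r)" using u \<sigma>_components_span by simp
      show "(\<Union>r\<in>{0, 1, 2}. \<sigma>_component r) \<subseteq> carr V" by (auto simp: \<sigma>_component_def)
      fix c assume "c \<in> (\<Union>r\<in>{0, 1, 2}. \<sigma>_component r)"
      then consider "c \<in> \<sigma>_component 0" | "c \<in> \<sigma>_component 1" | "c \<in> \<sigma>_component 2" by blast
      then have "act M c n x \<in> N \<union> ?R"
      proof cases
        case 1
        then show ?thesis using closed x by blast
      next
        case 2
        then have "act M c n x \<in> h_class (s + int 1)" using xs unfolding \<sigma>_component_def by blast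
        then show ?thesis by simp
      next
        case 3
        then have "act M c n x \<in> h_class (s + int 2)" using xs unfolding \<sigma>_component_def by blast
        then show ?thesis by simp
      qed
      then show "act M c n x \<in> mod.M.span (N \<union> ?R)" by (rule mod.M.span_base)
    qed
  qed
  then have full: "carr M \<subseteq> mod.M.span (N \<union> ?R)"
    unfolding B[symmetric] by (rule mod.M.span_minimal[OF _ mod.M.subspace_span])
  show "h_class s \<subseteq> N"
  proof
    fix x assume x: "x \<in> h_class s"
    then have "x \<in> mod.M.span (N \<union> ?R)" using full h_class_carr by blast
    then obtain y z where yz: "y \<in> mod.M.span N" "z \<in> mod.M.span ?R" "x = y + z"
      unfolding mod.M.span_Un by blast
    have y: "y \<in> N" using mod.M.span_minimal[OF subset_refl N(1)] yz(1) by blast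
    have "z \<in> h_class s"
      using mod.M.subspace_diff[OF h_class_subspace x, of y] y N(2) yz(3) by auto
    then have "z = 0"
    proof (rule h_class_independent[OF _ yz(2)])
      fix r assume "r \<in> {s + 1, s + 2}"
      then have "r = s + 1 \<or> r = s + 2" by simp
      then show "r mod 3 \<noteq> s mod 3" by presburger
    qed
    then show "x \<in> N" using y yz(3) by simp
  qed
qed (rule N(2))

lemma h_class_irreducible:
  assumes w: "w \<in> h_class s" "w \<noteq> 0"
  shows "irreducible_module (V\<lparr>carr := \<sigma>_component 0\<rparr>) (M\<lparr>carr := h_class s\<rparr>)"
  unfolding irreducible_module_def
proof (intro conjI allI impI)
  show "voa_module (V\<lparr>carr := \<sigma>_component 0\<rparr>) (M\<lparr>carr := h_class s\<rparr>)"
  proof (rule mod.restrict_voa_module)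
    show "V.subspace (\<sigma>_component 0)" by (rule \<sigma>_component_subspace)
    show "\<sigma>_component 0 \<subseteq> carr V" by (auto simp: \<sigma>_component_def)
    show "vac V \<in> \<sigma>_component 0" by (rule vac_\<sigma>_component)
    show "conf V \<in> \<sigma>_component 0"
      unfolding fixed_points_eq_\<sigma>_component[symmetric] by (simp add: conf_in \<sigma>_hom)
    show "mode V a n b \<in> \<sigma>_component 0" if "a \<in> \<sigma>_component 0" "b \<in> \<sigma>_component 0" for a b n
      using mode_\<sigma>_component[OF that] by simp
    show "act M a n w \<in> h_class s" if "a \<in> \<sigma>_component 0" "w \<in> h_class s" for a n w
      using that by (simp add: \<sigma>_component_def)
  qed (rule h_class_subspace, rule h_class_carr)
  show "carr (M\<lparr>carr := h_class s\<rparr>) \<noteq> {0}" using w by auto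
  fix N assume N: "submodule (V\<lparr>carr := \<sigma>_component 0\<rparr>) (M\<lparr>carr := h_class s\<rparr>) N"
  show "N = {0} \<or> N = carr (M\<lparr>carr := h_class s\<rparr>)"
  proof (cases "N = {0}")
    case False
    have N': "mod.M.subspace N" "N \<subseteq> h_class s" using N by (auto simp: submodule_def)
    then obtain x where "x \<in> N" "x \<noteq> 0" using False mod.M.subspace_0[OF N'(1)] by blast
    then have "N = h_class s"
      using fixed_point_submodule_of_h_class[OF N'] N by (simp add: submodule_def)
    then show ?thesis by simp
  qed simp
qed

lemma irreducible_generated_by_lowest_h_class:
  assumes w: "w \<in> h_class s" "w \<in> weight_space V M l" "w \<noteq> 0"
    and low: "\<And>l'. weight_space V M l' \<inter> h_class s \<noteq> {0} \<Longrightarrow> l \<le> l'"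
  shows "irreducible_generated_by_lowest (fixed_point_voa V {id, \<sigma>, \<sigma> \<circ> \<sigma>})
    (M\<lparr>carr := h_class s\<rparr>) w l"
proof -
  let ?V = "V\<lparr>carr := \<sigma>_component 0\<rparr>" and ?M = "M\<lparr>carr := h_class s\<rparr>"
  have irr: "irreducible_module ?V ?M" using w by (intro h_class_irreducible)
  have ws: "weight_space ?V ?M l' = weight_space V M l' \<inter> h_class s" for l'
    by (rule weight_space_restrict[OF h_class_carr])
  have "is_lowest_weight ?V ?M l" using w low unfolding is_lowest_weight_def ws by blast
  then have "lowest_weight_vector ?V ?M l w"
    using w by (simp add: lowest_weight_vector_def ws)
  moreover have "generated_submodule ?V ?M w = carr ?M"
  proof
    have "submodule ?V ?M (carr ?M)"
      using h_class_subspace by (auto simp: submodule_def \<sigma>_component_def)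
    then show "generated_submodule ?V ?M w \<subseteq> carr ?M"
      using w unfolding generated_submodule_def by auto
    show "carr ?M \<subseteq> generated_submodule ?V ?M w"
      unfolding generated_submodule_def
      using irreducible_submodule_eq_carr[OF irr _ _ w(3)] by blast
  qed
  ultimately show ?thesis
    using irr unfolding irreducible_generated_by_lowest_def fixed_point_voa_eq by blast
qed

lemma h_class_generated_by_v:
  assumes j: "j \<le> i" and w: "int (i - j) = s"
  shows "irreducible_generated_by_lowest (fixed_point_voa V {id, \<sigma>, \<sigma> \<circ> \<sigma>})
    (M\<lparr>carr := h_class s\<rparr>) (v j) top_weight"
proof (rule irreducible_generated_by_lowest_h_class)
  show "v j \<in> h_class s" using h_space_in_class[OF v_in_h_space[OF j]] w by simp
  fix l' assume "weight_space V M l' \<inter> h_class s \<noteq> {0}"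
  then have "weight_space V M l' \<noteq> {0}"
    using mod.M.subspace_0[OF h_class_subspace] by auto
  then show "top_weight \<le> l'"
    using is_lowest_top_weight by (simp add: is_lowest_weight_def)
qed (use v_in_top[OF j] v_nonzero[OF j] in simp_all)

end

section \<open>The case of the two-dimensional top level\<close>

lemma sl2_traces:
  "trace (sl2_h ** sl2_e) = 0" "trace (sl2_h ** sl2_f) = 0"
  "trace (sl2_e ** sl2_e) = 0" "trace (sl2_f ** sl2_f) = 0"
  "trace (sl2_e ** sl2_f) = 1" "trace (sl2_f ** sl2_e) = 1"
  by (simp_all add: trace_def sl2_h_def sl2_e_def sl2_f_def matrix_matrix_mult_def sum_2)

lemma bracket_self: "bracket a a = mscale 0 a"
  by (simp add: bracket_def mscale_def vec_eq_iff)

lemma bracket_f_e: "bracket sl2_f sl2_e = mscale (-1) sl2_h"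
  by (simp add: bracket_def mscale_def sl2_h_def sl2_e_def sl2_f_def
      matrix_matrix_mult_def vec_eq_iff forall_2 sum_2)

context affine_sl2_irreducible
begin

text \<open>
  The vector is nonzero because \<open>e(n)\<close> brings it back to \<open>(n k - 1) v 1\<close>.
\<close>

lemma lowering_vector:
  assumes i: "i = 1" and n: "n \<ge> 1" and nk: "n * k \<noteq> 1"
  shows "act M (\<iota> sl2_f) (- int n) (v 1) \<in> weight_space V M (top_weight + of_nat n)"
    and "act M (\<iota> sl2_f) (- int n) (v 1) \<in> h_class 2"
    and "act M (\<iota> sl2_f) (- int n) (v 1) \<noteq> 0"
proof -
  have v1: "v 1 \<in> carr M" "v 1 \<in> weight_space V M top_weight" "v 1 \<noteq> 0" "v 1 \<in> h_class 0"
    using i v_in[of 1] v_in_top[of 1] v_nonzero[of 1] h_space_in_class[OF v_in_h_space[of 1], of 0]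
    by simp_all
  show "act M (\<iota> sl2_f) (- int n) (v 1) \<in> weight_space V M (top_weight + of_nat n)"
    using iota_shifts_weight[OF sl2_basis_in(3) v1(2), of "- int n"] by simp
  show "act M (\<iota> sl2_f) (- int n) (v 1) \<in> h_class 2"
    using f_shifts_h_class[OF v1(4)] h_class_mod[of "-1" 2] by simp
  have "act M (\<iota> sl2_e) (int n) (act M (\<iota> sl2_f) (- int n) (v 1))
      = act M (\<iota> sl2_h) 0 (v 1) + scal M (of_nat n * of_nat k) (v 1)"
    using affine_commutator[OF sl2_basis_in(2,3) v1(1), of "int n" "- int n"] n
      iota_annihilates_top[OF sl2_basis_in(2) _ v1(2), of "int n"]
    by (simp add: sl2_brackets sl2_traces \<iota>_in sl2_basis_in)
  also have "\<dots> = scal M (of_nat (n * k) - 1) (v 1)"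
    using h0[of 1] i by (simp add: mod.M.scale_left_diff_distrib)
  also have "\<dots> \<noteq> 0"
  proof -
    have "(of_nat (n * k) :: complex) \<noteq> 1" using nk unfolding of_nat_eq_1_iff .
    then show ?thesis using v1(3) by simp
  qed
  finally show "act M (\<iota> sl2_f) (- int n) (v 1) \<noteq> 0"
    by (auto simp: \<iota>_in sl2_basis_in)
qed

lemma top_level_in_classes:
  assumes "i = 1"
  shows "weight_space V M top_weight \<subseteq> mod.M.span (\<Union>r\<in>{0, 1}. h_class r)"
  unfolding top_weight_space_span
proof (rule mod.M.span_mono, rule image_subsetI)
  fix j assume "j \<in> {..i}"
  then have "j \<le> i" by simp
  then have "v j \<in> h_class (int (i - j))" using h_space_in_class[OF v_in_h_space refl] by blast
  moreover have "int (i - j) \<in> {0, 1}" using assms by auto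
  ultimately show "v j \<in> (\<Union>r\<in>{0, 1}. h_class r)" by blast
qed

lemma classes_meet_class_2:
  assumes "w \<in> mod.M.span (\<Union>r\<in>{0, 1}. h_class r)" "w \<in> h_class 2"
  shows "w = 0"
  by (rule h_class_independent[OF assms(2,1)]) auto

text \<open>
  The assumption says that \<open>a(1) x(-1) u = 0\<close> on a basis of \<open>sl\<^sub>2\<close>; higher modes kill \<open>x(-1) u\<close> for
  degree reasons, so it is a singular vector above the top level and therefore zero.
\<close>

lemma first_degree_vanishing:
  assumes x: "x \<in> sl2" and u: "u \<in> weight_space V M top_weight"
    and sing: "\<And>a. a \<in> {sl2_h, sl2_e, sl2_f} \<Longrightarrow>
      act M (\<iota> (bracket a x)) 0 u + scal M (trace (a ** x) * of_nat k) u = 0"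
  shows "act M (\<iota> x) (-1) u = 0"
proof (rule no_singular_vectors)
  show "act M (\<iota> x) (-1) u \<in> weight_space V M (top_weight + 1)"
    using iota_shifts_weight[OF x u, of "-1"] by simp
  show "top_weight + 1 \<noteq> top_weight" by simp
  have uc: "u \<in> carr M" using u by (simp add: weight_space_def)
  have wc: "act M (\<iota> x) (-1) u \<in> carr M" using uc x by (simp add: mod.act_closed \<iota>_in)
  fix a and n :: int assume a: "a \<in> sl2" and n: "n \<ge> 1"
  have basis: "act M (\<iota> b) n (act M (\<iota> x) (-1) u) \<in> {0}" if b: "b \<in> {sl2_h, sl2_e, sl2_f}" for b
  proof -
    have bs: "b \<in> sl2" using b sl2_basis_in by auto
    have "act M (\<iota> b) n (act M (\<iota> x) (-1) u) = act M (\<iota> (bracket b x)) (n - 1) u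
        + (if n = 1 then scal M (trace (b ** x) * of_nat k) u else 0)"
      using affine_commutator[OF bs x uc, of n "-1"] iota_annihilates_top[OF bs n u] x
      by (simp add: \<iota>_in)
    also have "\<dots> = 0"
    proof (cases "n = 1")
      case True
      then show ?thesis using sing[OF b] by simp
    next
      case False
      then show ?thesis
        using iota_annihilates_top[OF bracket_in_sl2 _ u, of "n - 1"] n by simp
    qed
    finally show ?thesis by simp
  qed
  have "act M (\<iota> a) n (act M (\<iota> x) (-1) u) \<in> {0}"
    by (rule iota_in_subspace[OF a wc mod.M.subspace_single_0]) (rule basis, simp)+
  then show "act M (\<iota> a) n (act M (\<iota> x) (-1) u) = 0" by simp
qed

text \<open>
  At level one the vectors \<open>f(-1) v 1\<close> and \<open>e(-1) v 0\<close>, the only candidates in class \<open>2\<close>, are singular: their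
  obstructions are \<open>h(0) v 1 + k v 1\<close> and \<open>-h(0) v 0 + k v 0\<close>.
\<close>

lemma first_degree_in_classes:
  assumes k: "k = 1" and i: "i = 1"
  shows "weight_space V M (top_weight + 1) \<subseteq> mod.M.span (\<Union>r\<in>{0, 1}. h_class r)"
proof -
  let ?D = "mod.M.span (\<Union>r\<in>{0, 1}. h_class r)"
  have D: "x \<in> ?D" if "x \<in> h_class r" "r \<in> {0, 1}" for x r
    using that by (intro mod.M.span_base) blast
  have c: "v 0 \<in> carr M" "v 1 \<in> carr M" using i v_in by simp_all
  have t: "v 0 \<in> weight_space V M top_weight" "v 1 \<in> weight_space V M top_weight"
    using i v_in_top by simp_all
  have cl: "v 0 \<in> h_class 1" "v 1 \<in> h_class 0"
    using i h_space_in_class[OF v_in_h_space[of 0], of 1] h_space_in_class[OF v_in_h_space[of 1], of 0]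
    by simp_all
  have h: "act M (\<iota> sl2_h) 0 (v 0) = v 0" "act M (\<iota> sl2_h) 0 (v 1) = - v 1"
    using h0[of 0] h0[of 1] i by simp_all
  have f: "act M (\<iota> sl2_f) (-1) (v 1) = 0"
    by (rule first_degree_vanishing[OF sl2_basis_in(3) t(2)])
      (use c h f0_bot i k in \<open>auto simp: sl2_brackets sl2_traces bracket_self iota_mscale_act sl2_basis_in\<close>)
  have e: "act M (\<iota> sl2_e) (-1) (v 0) = 0"
    by (rule first_degree_vanishing[OF sl2_basis_in(2) t(1)])
      (use c h e0_top k in \<open>auto simp: sl2_brackets sl2_traces bracket_self bracket_f_e iota_mscale_act sl2_basis_in\<close>)
  have gen: "act M (\<iota> a) (-1) u \<in> ?D" if a: "a \<in> sl2" and u: "u \<in> weight_space V M top_weight" for a u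
  proof (rule mod.act_span[OF \<iota>_in[OF a] _ mod.M.subspace_span])
    show "u \<in> mod.M.span (v ` {..i})" using u unfolding top_weight_space_span .
    show "v ` {..i} \<subseteq> carr M" using v_in by auto
    fix x assume "x \<in> v ` {..i}"
    then obtain j where "j \<le> 1" "x = v j" using i by auto
    then have "x = v 0 \<or> x = v 1" by (cases j) auto
    then show "act M (\<iota> a) (-1) x \<in> ?D"
    proof
      assume x: "x = v 0"
      show ?thesis unfolding x
        using D[OF h_shifts_h_class[OF cl(1)]] D[OF f_shifts_h_class[OF cl(1)]]
        by (intro iota_in_subspace[OF a c(1) mod.M.subspace_span]) (simp_all add: e mod.M.span_zero)
    next
      assume x: "x = v 1"
      show ?thesis unfolding x
        using D[OF h_shifts_h_class[OF cl(2)]] D[OF e_shifts_h_class[OF cl(2)]]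
        by (intro iota_in_subspace[OF a c(2) mod.M.subspace_span]) (simp_all add: f mod.M.span_zero del: One_nat_def)
    qed
  qed
  show ?thesis
    using first_degree_spanned
  proof (rule subset_trans, intro mod.M.span_minimal mod.M.subspace_span subsetI)
    fix x assume "x \<in> {act M (\<iota> a) (-1) u | a u. a \<in> sl2 \<and> u \<in> weight_space V M top_weight}"
    then show "x \<in> ?D" using gen by blast
  qed
qed

end

text \<open>
  The weights of \<open>M\<close> are the top weight plus natural numbers, so it suffices that class \<open>2\<close> is absent
  below degree \<open>n\<close>.
\<close>

lemma (in z3_orbifold) h_class_2_generated:
  assumes i: "i = 1" and n: "n \<ge> 1" and nk: "n * k \<noteq> 1"
    and empty: "\<And>m. m < n \<Longrightarrow>
      weight_space V M (top_weight + of_nat m) \<subseteq> mod.M.span (\<Union>r\<in>{0, 1}. h_class r)"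
  shows "irreducible_generated_by_lowest (fixed_point_voa V {id, \<sigma>, \<sigma> \<circ> \<sigma>})
    (M\<lparr>carr := h_class 2\<rparr>) (act M (\<iota> sl2_f) (- int n) (v 1)) (top_weight + of_nat n)"
proof (rule irreducible_generated_by_lowest_h_class)
  fix l' assume "weight_space V M l' \<inter> h_class 2 \<noteq> {0}"
  moreover have "0 \<in> weight_space V M l' \<inter> h_class 2"
    using mod.mod_grading mod.M.subspace_0 mod.M.subspace_0[OF h_class_subspace]
    by (simp add: internal_direct_sum_def)
  ultimately obtain w where w: "w \<in> weight_space V M l'" "w \<in> h_class 2" "w \<noteq> 0" by blast
  obtain m :: nat where m: "l' = top_weight + of_nat m"
    by (rule weight_in_coset[OF span_weight_spaces_above_top w(1,3)])
  have "\<not> m < n"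
    using classes_meet_class_2[OF subsetD[OF empty]] w m by blast
  then show "top_weight + of_nat n \<le> l'"
    unfolding m by (simp add: less_eq_complex_def)
qed (use lowering_vector[OF i n nk] in simp_all)

theorem theorem3p4:
  fixes k i :: nat
    and V :: "('v::ab_group_add) voa"
    and \<iota> :: "mat2 \<Rightarrow> 'v"
    and \<sigma> :: "'v \<Rightarrow> 'v"
    and M :: "('v, 'm::ab_group_add) voa_mod"
    and v :: "nat \<Rightarrow> 'm"
  assumes "k \<ge> 1" and "0 < i" and "i \<le> k"
    and "simple_affine_sl2_voa V k \<iota>"
    and "voa_automorphism V \<sigma>"
    and "\<forall>a\<in>sl2. \<sigma> (\<iota> a) = \<iota> (sl2_sigma a)"
    and "affine_sl2_irreducible V k \<iota> i M v"
  shows "\<exists>M0 M1 M2.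
    internal_direct_sum (scal M) (carr M) {..<3::nat} (nth [M0, M1, M2]) \<and>
    (let VZ3 = fixed_point_voa V {id, \<sigma>, \<sigma> \<circ> \<sigma>};
         irr = (\<lambda>N. irreducible_generated_by_lowest VZ3 (M\<lparr>carr := N\<rparr>))
     in
      (k = 1 \<and> i = 1 \<longrightarrow>
         irr M0 (v 1) (1/4) \<and>
         irr M1 (v 0) (1/4) \<and>
         irr M2 (act M (\<iota> sl2_f) (-2) (v 1)) (9/4)) \<and>
      (k > 1 \<and> i = 1 \<longrightarrow>
         irr M0 (v 1) (3 / (4 * (of_nat k + 2))) \<and>
         irr M1 (v 0) (3 / (4 * (of_nat k + 2))) \<and>
         irr M2 (act M (\<iota> sl2_f) (-1) (v 1)) ((4 * of_nat k + 11) / (4 * (of_nat k + 2)))) \<and>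
      (1 < i \<longrightarrow>
         irr M0 (v i) (of_nat i * (of_nat i + 2) / (4 * (of_nat k + 2))) \<and>
         irr M1 (v (i - 1)) (of_nat i * (of_nat i + 2) / (4 * (of_nat k + 2))) \<and>
         irr M2 (v (i - 2)) (of_nat i * (of_nat i + 2) / (4 * (of_nat k + 2)))))"
proof -
  interpret affine_sl2_irreducible V k \<iota> i M v by fact
  interpret z3_orbifold V k \<iota> i M v \<sigma>
    by unfold_locales (use assms(5,6) in auto)
  let ?irr = "\<lambda>N. irreducible_generated_by_lowest (fixed_point_voa V {id, \<sigma>, \<sigma> \<circ> \<sigma>}) (M\<lparr>carr := N\<rparr>)"
  have 1: "?irr (h_class 0) (v 1) (1/4) \<and> ?irr (h_class 1) (v 0) (1/4) \<and>
      ?irr (h_class 2) (act M (\<iota> sl2_f) (-2) (v 1)) (9/4)" if "k = 1" "i = 1"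
  proof -
    have t: "1/4 = top_weight" unfolding top_weight_def using that by simp
    then have t2: "9/4 = top_weight + of_nat 2" by (simp add: t[symmetric])
    have "weight_space V M (top_weight + of_nat m) \<subseteq> mod.M.span (\<Union>r\<in>{0, 1}. h_class r)"
      if "m < 2" for m
      using that top_level_in_classes[OF \<open>i = 1\<close>] first_degree_in_classes[OF \<open>k = 1\<close> \<open>i = 1\<close>]
      by (cases "m = 0") (auto simp: less_2_cases_iff)
    then show ?thesis
      using h_class_generated_by_v[of 1 0] h_class_generated_by_v[of 0 1] h_class_2_generated[of 2] that
      unfolding t2 t by simp
  qed
  have 2: "?irr (h_class 0) (v 1) (3 / (4 * (of_nat k + 2))) \<and>
      ?irr (h_class 1) (v 0) (3 / (4 * (of_nat k + 2))) \<and>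
      ?irr (h_class 2) (act M (\<iota> sl2_f) (-1) (v 1)) ((4 * of_nat k + 11) / (4 * (of_nat k + 2)))"
    if "k > 1" "i = 1"
  proof -
    have t: "top_weight = 3 / (4 * (of_nat k + 2))" unfolding top_weight_def using that by simp
    have "of_nat (4 * (k + 2)) \<noteq> (0 :: complex)" unfolding of_nat_eq_0_iff by simp
    then have "4 * (of_nat k + 2) \<noteq> (0 :: complex)" by (simp only: of_nat_mult of_nat_add of_nat_numeral) simp
    moreover have "3 / d + 1 = (3 + d) / d" if "d \<noteq> 0" for d :: complex
      using that by (simp add: add_divide_distrib)
    ultimately have "top_weight + 1 = (3 + 4 * (of_nat k + 2)) / (4 * (of_nat k + 2))"
      unfolding t by blast
    then have t1: "top_weight + 1 = (4 * of_nat k + 11) / (4 * (of_nat k + 2))" by simp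
    show ?thesis
      using h_class_generated_by_v[of 1 0] h_class_generated_by_v[of 0 1] h_class_2_generated[of 1] that
        top_level_in_classes[OF that(2)]
      unfolding t1[symmetric] t[symmetric] by simp
  qed
  have 3: "?irr (h_class 0) (v i) top_weight \<and> ?irr (h_class 1) (v (i - 1)) top_weight \<and>
      ?irr (h_class 2) (v (i - 2)) top_weight" if "1 < i"
    using h_class_generated_by_v[of i 0] h_class_generated_by_v[of "i - 1" 1]
      h_class_generated_by_v[of "i - 2" 2] that by simp
  show ?thesis
    unfolding Let_def
    by (intro exI[of _ "h_class 0"] exI[of _ "h_class 1"] exI[of _ "h_class 2"] conjI impI
        h_classes_direct_sum) (use 1 2 3[unfolded top_weight_def] in simp_all)
qed

end
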